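(* Let $\xi_1,\ldots,\xi_n$ be independent scalar (real-valued) random variables, each with finite support, and for $j=1,\ldots,n$ let $\mathcal{S}_j$ denote the support of $\xi_j$. Let $\mathbf{u}_1,\ldots,\mathbf{u}_n\in\mathbb{C}^d$ and set $$\sigma^2=\Big\|\sum_{i=1}^n \mathbf{Var}[\xi_i]\,(\mathbf{u}_i\mathbf{u}_i^* )^2\Big\|.$$ Then $$\min_{\varepsilon_1\in\mathcal{S}_1,\ldots,\varepsilon_n\in\mathcal{S}_n}\Big\|\sum_{i=1}^n\mathbb{E}[\xi_i]\,\mathbf{u}_i\mathbf{u}_i^*-\sum_{i=1}^n\varepsilon_i\,\mathbf{u}_i\mathbf{u}_i^*\Big\|\le 3\sigma.$$
   Context: $\|\cdot\|$ denotes the spectral (operator) norm of a matrix; $\mathbf{u}^*$ is the conjugate transpose. *)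

theory Defs
  imports "HOL-Probability.Probability"
begin

definition outer :: "complex ^ 'd \<Rightarrow> complex ^ 'd ^ 'd" where
  "outer u = (\<chi> i j. u $ i * cnj (u $ j))"

definition spec_norm :: "complex ^ 'd ^ 'd \<Rightarrow> real" where
  "spec_norm A = onorm (\<lambda>x. A *v x)"

end

theory Submission
  imports Defs "HOL-Complex_Analysis.Complex_Analysis"
begin

text \<open>Write \<open>X\<^sub>i\<close> for the centred variables and \<open>A\<^sub>i = u\<^sub>i u\<^sub>i\<^sup>*\<close>. The polynomial
  \<open>det (x - \<Sum> X\<^sub>i A\<^sub>i) * det (x + \<Sum> X\<^sub>i A\<^sub>i)\<close> is a value of
  \<open>P = det (x + \<Sum> z\<^sub>i A\<^sub>i) * det (x + \<Sum> w\<^sub>i A\<^sub>i)\<close>, which is affine in each of \<open>z\<^sub>i\<close>, \<open>w\<^sub>i\<close> and has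
  no zeros with \<open>Im x > 0\<close> and all other imaginary parts nonnegative. Taking expectations over some of
  the \<open>X\<^sub>i\<close> preserves this, so all averages are real-rooted in \<open>x\<close> and have common interlacings; hence
  the \<open>X\<^sub>i\<close> can be fixed one after another without increasing the largest root. For the full average
  the expectation over \<open>X\<^sub>i\<close> is \<open>1 - Var X\<^sub>i * \<partial>\<^sub>z \<partial>\<^sub>w\<close> at \<open>z\<^sub>i = w\<^sub>i = 0\<close>, and a barrier argument that
  shifts \<open>z\<^sub>i\<close> and \<open>w\<^sub>i\<close> from \<open>- Var X\<^sub>i * |u\<^sub>i|\<^sup>2 / \<sigma>\<close> to \<open>0\<close> bounds its largest root by \<open>3 \<sigma>\<close>.\<close>

section \<open>Multiaffine functions\<close>

text \<open>For a function affine in each coordinate this difference is the partial derivative in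
  direction \<open>v\<close>, available over any commutative ring.\<close>

definition slope :: "(('v \<Rightarrow> 'a::comm_ring_1) \<Rightarrow> 'a) \<Rightarrow> 'v \<Rightarrow> ('v \<Rightarrow> 'a) \<Rightarrow> 'a" where
  "slope f v y = f (y(v := 1)) - f (y(v := 0))"

definition multiaffine :: "(('v \<Rightarrow> 'a::comm_ring_1) \<Rightarrow> 'a) \<Rightarrow> bool" where
  "multiaffine f \<longleftrightarrow> (\<forall>y v t. f (y(v := t)) = f (y(v := 0)) + t * slope f v y)"

lemma multiaffineD: "multiaffine f \<Longrightarrow> f (y(v := t)) = f (y(v := 0)) + t * slope f v y"
  unfolding multiaffine_def by blast

lemma multiaffine_shift:
  assumes "multiaffine f"
  shows "f (y(v := s + t)) = f (y(v := s)) + t * slope f v y"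
  using multiaffineD[OF assms, of y v s] multiaffineD[OF assms, of y v "s + t"]
  by (simp add: algebra_simps)

lemma slope_upd_same [simp]: "slope f v (y(v := t)) = slope f v y"
  by (simp add: slope_def)

lemma slope_commute: "slope (slope f v) v' = slope (slope f v') v"
  by (cases "v = v'") (auto simp: slope_def fun_eq_iff fun_upd_twist algebra_simps)

lemma multiaffine_slope: "multiaffine f \<Longrightarrow> multiaffine (slope f v)"
  unfolding multiaffine_def
proof (intro allI)
  fix y v' t assume f: "\<forall>y v t. f (y(v := t)) = f (y(v := 0)) + t * slope f v y"
  show "slope f v (y(v' := t)) = slope f v (y(v' := 0)) + t * slope (slope f v) v' y"
  proof (cases "v = v'")
    case True then show ?thesis by (simp add: slope_def)
  next
    case False
    have "f (y(v' := t, v := s)) = f (y(v' := 0, v := s)) + t * slope f v' (y(v := s))" for s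
      using f[rule_format, of "y(v := s)" v' t] False by (simp add: fun_upd_twist)
    then show ?thesis unfolding slope_commute[of f v v'] by (simp add: slope_def[of f v] slope_def[of "slope f v'" v] algebra_simps)
  qed
qed

lemma multiaffine_shift2:
  assumes "multiaffine f" "v \<noteq> v'"
  shows "f (y(v := s + a, v' := t + b)) = f (y(v := s, v' := t))
    + a * slope f v (y(v' := t)) + b * slope f v' (y(v := s)) + a * b * slope (slope f v) v' y"
proof -
  have "f (y(v := s + a, v' := t + b)) = f (y(v := s + a, v' := t)) + b * slope f v' (y(v := s + a))"
    by (rule multiaffine_shift[OF assms(1)])
  moreover have "f (y(v := s + a, v' := t)) = f (y(v := s, v' := t)) + a * slope f v (y(v' := t))"
    using multiaffine_shift[OF assms(1), of "y(v' := t)" v s a] assms(2) by (simp add: fun_upd_twist)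
  moreover have "slope f v' (y(v := s + a)) = slope f v' (y(v := s)) + a * slope (slope f v) v' y"
    using multiaffine_shift[OF multiaffine_slope[OF assms(1)], of v' y v s a] by (simp add: slope_commute)
  ultimately show ?thesis by (simp add: algebra_simps)
qed

section \<open>Averaging over a pair of variables\<close>

text \<open>If \<open>X\<close> has mean \<open>m\<close> and variance \<open>c\<close>, then \<open>pair_op m c i f\<close> is the expectation of a
  multiaffine \<open>f\<close> with \<open>(i, True)\<close> set to \<open>-X\<close> and \<open>(i, False)\<close> set to \<open>X\<close>.\<close>

definition pair_op :: "'a \<Rightarrow> 'a \<Rightarrow> nat \<Rightarrow> ((nat \<times> bool \<Rightarrow> 'a::comm_ring_1) \<Rightarrow> 'a) \<Rightarrow> (nat \<times> bool \<Rightarrow> 'a) \<Rightarrow> 'a" where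
  "pair_op m c i f y = f (y((i,True) := - m, (i,False) := m)) - c * slope (slope f (i,True)) (i,False) y"

primrec iter_op :: "(nat \<Rightarrow> 'a) \<Rightarrow> (nat \<Rightarrow> 'a) \<Rightarrow> nat \<Rightarrow> ((nat \<times> bool \<Rightarrow> 'a::comm_ring_1) \<Rightarrow> 'a) \<Rightarrow> (nat \<times> bool \<Rightarrow> 'a) \<Rightarrow> 'a" where
  "iter_op m c 0 f = f"
| "iter_op m c (Suc k) f = pair_op (m (Suc k)) (c (Suc k)) (Suc k) (iter_op m c k f)"

lemma slope_pair_op_same: "slope (pair_op m c i f) (i, b) y = 0"
  by (cases b) (simp_all add: slope_def pair_op_def fun_upd_twist)

lemma pair_op_upd_same: "pair_op m c i f (y((i, b) := t)) = pair_op m c i f y"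
  by (cases b) (simp_all add: slope_def pair_op_def fun_upd_twist)

lemma slope_pair_op:
  "fst v \<noteq> i \<Longrightarrow> slope (pair_op m c i f) v = pair_op m c i (slope f v)"
  by (cases v) (auto simp: slope_def pair_op_def fun_eq_iff fun_upd_twist algebra_simps)

lemma multiaffine_pair_op:
  assumes "multiaffine f" shows "multiaffine (pair_op m c i f)"
  unfolding multiaffine_def
proof (intro allI)
  fix y v t
  show "pair_op m c i f (y(v := t)) = pair_op m c i f (y(v := 0)) + t * slope (pair_op m c i f) v y"
  proof (cases "fst v = i")
    case True
    then show ?thesis by (cases v) (simp add: pair_op_upd_same slope_pair_op_same)
  next
    case False
    have "f (y(v := t, (i,True) := a, (i,False) := b)) = f (y(v := 0, (i,True) := a, (i,False) := b))
        + t * slope f v (y((i,True) := a, (i,False) := b))" for a b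
    proof -
      have "y(v := s, (i,True) := a, (i,False) := b) = y((i,True) := a, (i,False) := b, v := s)" for s
        using False by (auto simp: fun_eq_iff)
      then show ?thesis using multiaffineD[OF assms, of "y((i,True) := a, (i,False) := b)" v t] by simp
    qed
    moreover have "slope (slope f (i,True)) (i,False) (y(v := t)) = slope (slope f (i,True)) (i,False) (y(v := 0))
      + t * slope (slope (slope f v) (i,True)) (i,False) y"
      using multiaffineD[OF multiaffine_slope[OF multiaffine_slope[OF assms]], of "(i,True)" "(i,False)" y v t]
        slope_commute[of f "(i,True)" v] slope_commute[of "slope f (i,True)" "(i,False)" v] by simp
    ultimately show ?thesis using False
      by (simp add: slope_pair_op) (simp add: pair_op_def algebra_simps)
  qed
qed

lemma multiaffine_iter_op: "multiaffine f \<Longrightarrow> multiaffine (iter_op m c k f)"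
  by (induction k) (auto intro: multiaffine_pair_op)

text \<open>The quadratic obtained for \<open>a = b\<close> would have roots with product \<open>c\<close>, hence one of them in the
  closed upper half-plane.\<close>

lemma bilinear_mean_nonzero:
  fixes c00 c10 c01 c11 :: complex and c :: real
  assumes c: "c \<ge> 0"
    and nz: "\<And>a b. Im a \<ge> 0 \<Longrightarrow> Im b \<ge> 0 \<Longrightarrow> c00 + a * c10 + b * c01 + a * b * c11 \<noteq> 0"
  shows "c00 - of_real c * c11 \<noteq> 0"
proof
  assume 0: "c00 - of_real c * c11 = 0"
  have "c00 \<noteq> 0" using nz[of 0 0] by simp
  with 0 have c11: "c11 \<noteq> 0" and cpos: "c > 0" using c by (auto simp: less_le)
  \<comment> \<open>With \<open>a = b = s\<close> and \<open>c00 = c * c11\<close> the expression in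
    \<open>nz\<close> is \<open>c11\<close> times the monic quadratic in \<open>s\<close> with
    linear coefficient \<open>p\<close> and constant term \<open>c\<close>.\<close>
  define p where "p = (c10 + c01) / c11"
  define r where "r = (- p + csqrt (p^2 - 4 * c)) / 2"
  have r: "r^2 + p * r + c = 0"
  proof -
    have "2 * (x / 2) = x" for x :: complex by simp
    from this[of "- p + csqrt (p^2 - 4 * c)"] have "2 * r + p = csqrt (p^2 - 4 * c)"
      unfolding r_def by (metis add.commute add.left_commute add.right_neutral add.right_inverse)
    then have "(2 * r + p)^2 = p^2 - 4 * c" by simp
    then have "4 * (r^2 + p * r + c) = 0" by (simp add: power2_eq_square algebra_simps)
    then have "(4::complex) = 0 \<or> r^2 + p * r + c = 0" by (simp only: mult_eq_0_iff)
    then show ?thesis by simp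
  qed
  have rnz: "r \<noteq> 0" using r cpos by auto
  have root: "False" if "s^2 + p * s + c = 0" "Im s \<ge> 0" for s
  proof -
    have "c00 + s * c10 + s * c01 + s * s * c11 = c11 * (s^2 + p * s + c)"
      using 0 c11 by (simp add: p_def field_simps power2_eq_square)
    then show False using nz[OF that(2) that(2)] that(1) by simp
  qed
  show False
  proof (cases "Im r \<ge> 0")
    case True then show False using root r by blast
  next
    case False
    \<comment> \<open>\<open>c / r\<close> is the other root; as \<open>c > 0\<close>, its imaginary
      part has the opposite sign to that of \<open>r\<close>.\<close>
    have "(c / r)^2 + p * (c / r) + c = c * (r^2 + p * r + c) / r^2"
      using rnz by (simp add: field_simps power2_eq_square)
    moreover have "Im (c / r) \<ge> 0"
      using False cpos by (simp add: Im_divide divide_nonpos_nonneg mult_le_0_iff)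
    ultimately show False using root[of "c / r"] r by simp
  qed
qed

text \<open>Displacing the two coordinates from the real points \<open>- m\<close> and
  \<open>m\<close> by \<open>a\<close> and \<open>b\<close> in the closed upper half-plane keeps all
  imaginary parts nonnegative, so the bilinear expansion in \<open>a\<close> and \<open>b\<close>
  never vanishes. The average is its constant term minus \<open>c\<close> times its top
  coefficient.\<close>

lemma pair_op_nonzero:
  fixes f :: "(nat \<times> bool \<Rightarrow> complex) \<Rightarrow> complex"
  assumes f: "multiaffine f" and nz: "\<And>y. (\<And>v. Im (y v) \<ge> 0) \<Longrightarrow> f y \<noteq> 0"
    and y: "\<And>v. Im (y v) \<ge> 0" and c: "c \<ge> 0"
  shows "pair_op (of_real m) (of_real c) i f y \<noteq> 0"
  unfolding pair_op_def
proof (rule bilinear_mean_nonzero[OF c])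
  fix a b :: complex assume "Im a \<ge> 0" "Im b \<ge> 0"
  then show "f (y((i, True) := - of_real m, (i, False) := of_real m))
     + a * slope f (i,True) (y((i,False) := of_real m)) + b * slope f (i,False) (y((i,True) := - of_real m))
     + a * b * slope (slope f (i,True)) (i,False) y \<noteq> 0"
    using nz[of "y((i, True) := - of_real m + a, (i, False) := of_real m + b)"] y
    by (subst multiaffine_shift2[OF f, symmetric]) auto
qed

lemma iter_op_nonzero:
  fixes f :: "(nat \<times> bool \<Rightarrow> complex) \<Rightarrow> complex"
  assumes f: "multiaffine f" and nz: "\<And>y. (\<And>v. Im (y v) \<ge> 0) \<Longrightarrow> f y \<noteq> 0"
    and c: "\<And>i. c i \<ge> 0"
  shows "(\<And>v. Im (y v) \<ge> 0) \<Longrightarrow> iter_op (\<lambda>i. of_real (m i)) (\<lambda>i. of_real (c i)) k f y \<noteq> 0"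
proof (induction k arbitrary: y)
  case (Suc k)
  then show ?case
    using pair_op_nonzero[OF multiaffine_iter_op[OF f] Suc.IH Suc.prems c] by simp
qed (use nz in simp)

section \<open>Passing between real and complex arguments\<close>

lemma iter_op_of_real:
  fixes g :: "(nat \<times> bool \<Rightarrow> real) \<Rightarrow> real"
  assumes "\<And>y. of_real (g y) = f (\<lambda>v. of_real (y v))"
  shows "of_real (iter_op m c k g y) = iter_op (\<lambda>i. complex_of_real (m i)) (\<lambda>i. of_real (c i)) k f (\<lambda>v. of_real (y v))"
proof (induction k arbitrary: y)
  case (Suc k)
  have *: "(\<lambda>v. complex_of_real (y v))(v := of_real t) = (\<lambda>w. of_real ((y(v := t)) w))" for y :: "nat \<times> bool \<Rightarrow> real" and v t
    by auto
  have **: "(\<lambda>v. complex_of_real (y v))(v := 0) = (\<lambda>w. of_real ((y(v := 0)) w))"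
    "(\<lambda>v. complex_of_real (y v))(v := 1) = (\<lambda>w. of_real ((y(v := 1)) w))"
    "(\<lambda>v. complex_of_real (y v))(v := - of_real t) = (\<lambda>w. of_real ((y(v := - t)) w))" for y :: "nat \<times> bool \<Rightarrow> real" and v t
    by auto
  show ?case
    by (simp only: iter_op.simps pair_op_def slope_def of_real_diff of_real_mult Suc.IH * **)
qed (use assms in simp)

lemma slope_of_real:
  fixes g :: "('v \<Rightarrow> real) \<Rightarrow> real"
  assumes "\<And>y. of_real (g y) = f (\<lambda>v. of_real (y v))"
  shows "complex_of_real (slope g v y) = slope f v (\<lambda>v. of_real (y v))"
proof -
  have *: "(\<lambda>v. complex_of_real (y v))(v := of_real t) = (\<lambda>w. of_real ((y(v := t)) w))" for t
    by auto
  show ?thesis using *[of 0] *[of 1] by (simp add: slope_def assms)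
qed

lemma multiaffine_of_real:
  fixes g :: "('v \<Rightarrow> real) \<Rightarrow> real"
  assumes g: "\<And>y. complex_of_real (g y) = f (\<lambda>v. of_real (y v))" and f: "multiaffine f"
  shows "multiaffine g"
  unfolding multiaffine_def
proof (intro allI)
  fix y :: "'v \<Rightarrow> real" and v t
  have *: "(\<lambda>v. complex_of_real (y v))(v := of_real t) = (\<lambda>w. of_real ((y(v := t)) w))" for t
    by auto
  have "complex_of_real (g (y(v := t))) = of_real (g (y(v := 0)) + t * slope g v y)"
    using multiaffineD[OF f, of "\<lambda>v. complex_of_real (y v)" v "of_real t"] *[of t] *[of 0]
    by (simp add: g slope_of_real[of g f, OF g])
  then show "g (y(v := t)) = g (y(v := 0)) + t * slope g v y" by (simp only: of_real_eq_iff)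
qed

section \<open>Rayleigh inequalities\<close>

text \<open>Put \<open>b = \<i>\<close> and solve the bilinear equation for \<open>a\<close>. The
  solution \<open>q s\<close> tends to a number with imaginary part
  \<open>(A * D - B * C) / (B^2 + D^2)\<close>. Were this positive, \<open>q s\<close> would be a
  forbidden zero for small \<open>s > 0\<close>.\<close>

lemma rayleigh_limit:
  fixes h h1 h2 h12 :: "real \<Rightarrow> complex"
  assumes cont: "isCont h 0" "isCont h1 0" "isCont h2 0" "isCont h12 0"
    and nz: "\<And>s a b. s > 0 \<Longrightarrow> Im a \<ge> 0 \<Longrightarrow> Im b \<ge> 0 \<Longrightarrow> h s + a * h1 s + b * h2 s + a * b * h12 s \<noteq> 0"
    and re: "h 0 = of_real A" "h1 0 = of_real B" "h2 0 = of_real C" "h12 0 = of_real D"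
  shows "A * D \<le> B * C"
proof (rule ccontr)
  assume neg: "\<not> A * D \<le> B * C"
  define den where "den = (\<lambda>s. h1 s + \<i> * h12 s)"
  define q where "q = (\<lambda>s. - (h s + \<i> * h2 s) / den s)"
  have den0: "den 0 \<noteq> 0"
    using neg by (auto simp: den_def re complex_eq_iff)
  have cd: "isCont den 0" unfolding den_def by (intro continuous_intros cont)
  have cq: "isCont q 0" unfolding q_def by (intro continuous_intros cont cd den0)
  have "Im (q 0) = (A * D - B * C) / (B^2 + D^2)"
    by (simp add: q_def den_def re Im_divide algebra_simps)
  also have "\<dots> > 0" using neg den0
    by (intro divide_pos_pos) (auto simp: den_def re complex_eq_iff sum_power2_gt_zero_iff)
  finally have q0: "Im (q 0) > 0" .
  have "eventually (\<lambda>s. Im (q s) > 0) (at_right 0)"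
    by (rule order_tendstoD(1)[OF _ q0])
      (intro tendsto_intros, use cq in \<open>simp add: isCont_def filterlim_at_split\<close>)
  moreover have "eventually (\<lambda>s. den s \<noteq> 0) (at_right 0)"
    using tendsto_imp_eventually_ne[OF _ den0, of den "at_right 0"] cd
    by (simp add: isCont_def filterlim_at_split)
  moreover have "eventually (\<lambda>s. s > (0::real)) (at_right 0)" by (rule eventually_at_right_less)
  ultimately have "eventually (\<lambda>s. False) (at_right (0::real))"
  proof eventually_elim
    case (elim s)
    have "h s + q s * h1 s + \<i> * h2 s + q s * \<i> * h12 s = h s + \<i> * h2 s + q s * den s"
      by (simp add: den_def algebra_simps)
    also have "\<dots> = 0" using elim by (simp add: q_def)
    finally show False using nz[of s "q s" \<i>] elim by simp
  qed
  then show False by simp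
qed

text \<open>\<open>B0\<close>, \<open>B1\<close> and \<open>B2\<close> are the entries of the Bezoutian of the two quadratics
  \<open>t \<mapsto> F + t * (Fz + Fw) + t\<^sup>2 * Fzw\<close> and \<open>t \<mapsto> Fy + t * (Fyz + Fyw) + t\<^sup>2 * Fyzw\<close>.\<close>

lemma barrier_algebra:
  fixes F Fy Fz Fw Fyz Fyw Fzw Fyzw c d :: real
  assumes F: "F > 0" "Fz \<ge> 0" "Fw \<ge> 0" "Fzw \<ge> 0"
    and R1: "\<And>t. (F + t * Fw) * (Fyz + t * Fyzw) \<le> (Fy + t * Fyw) * (Fz + t * Fzw)"
    and R2: "\<And>t. (F + t * Fz) * (Fyw + t * Fyzw) \<le> (Fy + t * Fyz) * (Fw + t * Fzw)"
    and c: "c \<ge> 0" "d \<ge> 0" "c * (Fz + Fw) \<le> d * F"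
  shows "F * (Fy + d * (Fyz + Fyw) + (d^2 - c) * Fyzw) \<le> Fy * (F + d * (Fz + Fw) + (d^2 - c) * Fzw)"
proof -
  define S where "S = Fz + Fw"
  define B0 where "B0 = S * Fy - F * (Fyz + Fyw)"
  define B1 where "B1 = Fzw * Fy - F * Fyzw"
  define B2 where "B2 = Fzw * (Fyz + Fyw) - S * Fyzw"
  \<comment> \<open>Adding \<open>R1\<close> and \<open>R2\<close> cancels the mixed products
    \<open>Fyw * Fz\<close> and \<open>Fyz * Fw\<close>. A quadratic that is nonnegative for every
    real \<open>t\<close> then has nonpositive discriminant.\<close>
  have W: "B0 + 2 * t * B1 + t^2 * B2 \<ge> 0" for t
    using R1[of t] R2[of t]
    by (simp add: B0_def B1_def B2_def S_def algebra_simps power2_eq_square)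
  have B0: "B0 \<ge> 0" using W[of 0] by simp
  have disc: "B1^2 \<le> B0 * B2"
  proof (cases "B2 = 0")
    case True
    have "B1 = 0"
    proof (rule ccontr)
      assume "B1 \<noteq> 0"
      then show False using W[of "- (B0 + 1) / (2 * B1)"] True by (simp add: field_simps)
    qed
    then show ?thesis using True by simp
  next
    case False
    have "B2 \<ge> 0"
    proof (rule ccontr)
      assume "\<not> B2 \<ge> 0"
      then have n: "B2 < 0" by simp
      define t where "t = 1 + (B0 + 2 * \<bar>B1\<bar>) / - B2"
      have t1: "t \<ge> 1" using n B0 by (simp add: t_def divide_nonneg_neg)
      have "B0 + 2 * t * B1 \<le> t * (B0 + 2 * \<bar>B1\<bar>)"
      proof -
        have "B0 \<le> t * B0" "t * B1 \<le> t * \<bar>B1\<bar>"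
          using t1 B0 mult_right_mono[of 1 t B0] by (auto intro: mult_left_mono)
        then show ?thesis by (simp add: algebra_simps)
      qed
      also have "\<dots> = t * ((t - 1) * - B2)" using n by (simp add: t_def)
      also have "\<dots> < t * (t * - B2)" using t1 n by (intro mult_strict_left_mono mult_strict_right_mono) auto
      finally show False using W[of t] by (simp add: power2_eq_square mult.assoc)
    qed
    then have "0 \<le> B2 * (B0 + 2 * (- B1 / B2) * B1 + (- B1 / B2)^2 * B2)" using W[of "- B1 / B2"] by (rule mult_nonneg_nonneg)
    also have "\<dots> = B0 * B2 - B1^2" using False by (simp add: field_simps power2_eq_square)
    finally show ?thesis by simp
  qed
  have S: "S \<ge> 0" using F by (simp add: S_def)
  \<comment> \<open>This relation eliminates \<open>B2\<close> from the discriminant bound; what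
    remains forces \<open>B1 \<ge> 0\<close> and \<open>F * B1 \<le> S * B0\<close>.\<close>
  have eq: "F * B2 = S * B1 - Fzw * B0" by (simp add: B0_def B1_def B2_def algebra_simps)
  have le: "F * B1^2 \<le> S * (B0 * B1)"
  proof -
    have "F * B1^2 \<le> F * (B0 * B2)" using disc F by simp
    also have "\<dots> = B0 * (S * B1 - Fzw * B0)" using eq by (metis mult.left_commute)
    also have "\<dots> \<le> S * (B0 * B1)" using F B0 by (simp add: algebra_simps)
    finally show ?thesis .
  qed
  have B1: "B1 \<ge> 0"
  proof (rule ccontr)
    assume "\<not> B1 \<ge> 0"
    then have "F * B1^2 > 0" "S * (B0 * B1) \<le> 0" using F S B0 by (auto simp: mult_nonneg_nonpos)
    then show False using le by simp
  qed
  have FB: "F * B1 \<le> S * B0"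
  proof (cases "B1 = 0")
    case False
    then have "B1 > 0" using B1 by simp
    have "(F * B1) * B1 \<le> (S * B0) * B1" using le by (simp add: power2_eq_square mult.assoc)
    then show ?thesis using \<open>B1 > 0\<close> by simp
  qed (use S B0 in simp)
  \<comment> \<open>The claim rearranges to \<open>d * B0 + (d^2 - c) * B1 \<ge> 0\<close>, so
    \<open>c * B1 \<le> d * B0\<close> suffices.\<close>
  have "F * (c * B1) \<le> F * (d * B0)"
  proof -
    have "F * (c * B1) \<le> c * S * B0" using mult_left_mono[OF FB c(1)] by (simp add: mult_ac)
    also have "\<dots> \<le> d * F * B0" using c(3) B0 by (intro mult_right_mono) (auto simp: S_def)
    finally show ?thesis by (simp add: mult_ac)
  qed
  then have "c * B1 \<le> d * B0" using F by simp
  moreover have "0 \<le> d^2 * B1" using B1 by simp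
  ultimately show ?thesis by (simp add: B0_def B1_def S_def algebra_simps)
qed

section \<open>The barrier argument\<close>

lemma affine_slope_nonneg:
  fixes A B :: real
  assumes "\<And>t. t \<ge> 0 \<Longrightarrow> A + t * B \<ge> 0"
  shows "B \<ge> 0"
proof (rule ccontr)
  assume "\<not> B \<ge> 0"
  then have B: "B < 0" by simp
  then have "(\<bar>A\<bar> + 1) / - B \<ge> 0" by (intro divide_nonneg_pos) auto
  from assms[OF this] B show False by simp
qed

text \<open>The invariant is positivity together with logarithmic derivatives at most
  \<open>C j\<close> on the orthant bounded by \<open>- d\<close>. Moving both variables of pair
  \<open>i\<close> from \<open>- d i\<close> up to 0 gains enough to pay for the term with
  \<open>c\<close>, so the invariant passes to the later pairs with the same
  \<open>C\<close>.\<close>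

lemma barrier_step:
  fixes f :: "(nat \<times> bool \<Rightarrow> real) \<Rightarrow> real" and d C :: "nat \<Rightarrow> real"
  assumes f: "multiaffine f"
    and rayleigh: "\<And>v v' y. v \<noteq> v' \<Longrightarrow> f y * slope (slope f v) v' y \<le> slope f v y * slope f v' y"
    and pos: "\<And>y. (\<And>j b. j \<ge> i \<Longrightarrow> y (j, b) \<ge> - d j) \<Longrightarrow> f y > 0"
    and slopes: "\<And>y j b. (\<And>j b. j \<ge> i \<Longrightarrow> y (j, b) \<ge> - d j) \<Longrightarrow> j \<ge> i \<Longrightarrow> slope f (j, b) y \<le> C j * f y"
    and d: "d i \<ge> 0" and c: "c \<ge> 0" "c * (2 * C i) \<le> d i"
    and y: "\<And>j b. j > i \<Longrightarrow> y (j, b) \<ge> - d j"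
  shows "pair_op 0 c i f y > 0 \<and> (\<forall>j>i. \<forall>b. slope (pair_op 0 c i f) (j, b) y \<le> C j * pair_op 0 c i f y)"
proof -
  let ?z = "(i, True)" and ?w = "(i, False)"
  define corner where "corner a b = y(?z := - d i + a, ?w := - d i + b)" for a b
  have orthant: "corner a b (j, b') \<ge> - d j" if "a \<ge> 0" "b \<ge> 0" "j \<ge> i" for a b j b'
    using that y by (auto simp: corner_def)
  define F Fz Fw Fzw where "F = f (corner 0 0)" and "Fz = slope f ?z (y(?w := - d i))"
    and "Fw = slope f ?w (y(?z := - d i))" and "Fzw = slope (slope f ?z) ?w y"
  have f_at: "f (corner a b) = F + a * Fz + b * Fw + a * b * Fzw" for a b
    using multiaffine_shift2[OF f, of ?z ?w y "- d i" a "- d i" b]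
    by (simp add: corner_def F_def Fz_def Fw_def Fzw_def)
  have fpos: "F + a * Fz + b * Fw + a * b * Fzw > 0" if "a \<ge> 0" "b \<ge> 0" for a b
    unfolding f_at[symmetric] by (rule pos) (use orthant that in auto)
  have F: "F > 0" using fpos[of 0 0] by simp
  \<comment> \<open>\<open>f\<close> stays positive when moving up from the corner, so its affine
    coefficients there cannot be negative.\<close>
  have Fz: "Fz \<ge> 0" by (rule affine_slope_nonneg[of F]) (use fpos[of _ 0] in \<open>simp add: less_imp_le\<close>)
  have Fwa: "Fw + a * Fzw \<ge> 0" if "a \<ge> 0" for a
    by (rule affine_slope_nonneg[of "F + a * Fz"])
      (use fpos[OF that] in \<open>simp add: less_imp_le algebra_simps\<close>)
  have Fw: "Fw \<ge> 0" using Fwa[of 0] by simp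
  have Fzw: "Fzw \<ge> 0" by (rule affine_slope_nonneg[of Fw]) (rule Fwa)
  have sz: "slope f ?z (corner a b) = Fz + b * Fzw" for a b
    using multiaffine_shift[OF multiaffine_slope[OF f], of ?z y ?w "- d i" b]
    by (simp add: corner_def Fz_def Fzw_def fun_upd_twist)
  have sw: "slope f ?w (corner a b) = Fw + a * Fzw" for a b
    using multiaffine_shift[OF multiaffine_slope[OF f], of ?w y ?z "- d i" a]
    by (simp add: corner_def Fw_def Fzw_def slope_commute[of f ?z])
  have szw: "slope (slope f ?z) ?w (corner a b) = Fzw" for a b
    by (simp add: corner_def Fzw_def) (simp add: slope_commute[of f ?z ?w])
  have slopeF: "slope f (j, b) (corner 0 0) \<le> C j * F" if "j \<ge> i" for j b
    unfolding F_def by (rule slopes) (use orthant that in auto)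
  have cF: "c * (Fz + Fw) \<le> d i * F"
  proof -
    have "Fz + Fw \<le> 2 * C i * F"
      using slopeF[of i True] slopeF[of i False] by (simp add: sz sw)
    then have "c * (Fz + Fw) \<le> c * (2 * C i) * F"
      using c(1) mult_left_mono[of "Fz + Fw" "2 * C i * F" c] by (simp add: mult_ac)
    also have "\<dots> \<le> d i * F" using c(2) F by (intro mult_right_mono) auto
    finally show ?thesis .
  qed
  \<comment> \<open>The average is taken at 0, a displacement by \<open>d i\<close> from the corner
    in both coordinates. The general \<open>g\<close> covers both \<open>f\<close> and its
    slopes.\<close>
  have op: "pair_op 0 c i g y = g (corner 0 0) + d i * (slope g ?z (y(?w := - d i)) + slope g ?w (y(?z := - d i)))
      + ((d i)^2 - c) * slope (slope g ?z) ?w y" if "multiaffine g" for g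
    using multiaffine_shift2[OF that, of ?z ?w y "- d i" "d i" "- d i" "d i"]
    by (simp add: corner_def pair_op_def algebra_simps power2_eq_square)
  define N where "N = pair_op 0 c i f y"
  have N: "N = F + d i * (Fz + Fw) + ((d i)^2 - c) * Fzw"
    unfolding N_def op[OF f] by (simp add: F_def Fz_def Fw_def Fzw_def)
  have "N > 0"
  proof -
    \<comment> \<open>In \<open>N\<close> only \<open>c * Fzw\<close> enters negatively; the
      Rayleigh inequality and the barrier at pair \<open>i\<close> bound it by
      \<open>d i * Fw\<close>.\<close>
    have "F * Fzw \<le> Fz * Fw"
      using rayleigh[of ?z ?w "corner 0 0"] by (simp add: f_at sz sw szw)
    from mult_left_mono[OF this c(1)] have "F * (c * Fzw) \<le> c * Fz * Fw" by (simp add: mult_ac)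
    also have "\<dots> \<le> c * (Fz + Fw) * Fw" using c Fz Fw by (intro mult_right_mono mult_left_mono) auto
    also have "\<dots> \<le> d i * F * Fw" using cF Fw by (intro mult_right_mono)
    finally have "c * Fzw \<le> d i * Fw" using F by (simp add: mult_ac)
    moreover have "0 \<le> d i * Fz" "0 \<le> (d i)^2 * Fzw" using d Fz Fzw by auto
    ultimately show ?thesis using F unfolding N by (simp add: algebra_simps)
  qed
  moreover have "slope (pair_op 0 c i f) (j, b) y \<le> C j * N" if j: "j > i" for j b
  proof -
    let ?v = "(j, b)"
    define g where "g = slope f ?v"
    have g: "multiaffine g" unfolding g_def by (rule multiaffine_slope[OF f])
    define Fy Fyz Fyw Fyzw where "Fy = g (corner 0 0)" and "Fyz = slope g ?z (y(?w := - d i))"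
      and "Fyw = slope g ?w (y(?z := - d i))" and "Fyzw = slope (slope g ?z) ?w y"
    have g_at: "g (corner a b) = Fy + a * Fyz + b * Fyw + a * b * Fyzw" for a b
      using multiaffine_shift2[OF g, of ?z ?w y "- d i" a "- d i" b]
      by (simp add: corner_def Fy_def Fyz_def Fyw_def Fyzw_def)
    have gz: "slope g ?z (corner a b) = Fyz + b * Fyzw" for a b
      using multiaffine_shift[OF multiaffine_slope[OF g], of ?z y ?w "- d i" b]
      by (simp add: corner_def Fyz_def Fyzw_def fun_upd_twist)
    have gw: "slope g ?w (corner a b) = Fyw + a * Fyzw" for a b
      using multiaffine_shift[OF multiaffine_slope[OF g], of ?w y ?z "- d i" a]
      by (simp add: corner_def Fyw_def Fyzw_def slope_commute[of g ?z])
    \<comment> \<open>So the ratio of slope to value of the average at \<open>y\<close> is at most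
      \<open>Fy / F\<close>, the ratio for \<open>f\<close> at the corner, which is at most
      \<open>C j\<close>.\<close>
    have "F * (Fy + d i * (Fyz + Fyw) + ((d i)^2 - c) * Fyzw) \<le> Fy * (F + d i * (Fz + Fw) + ((d i)^2 - c) * Fzw)"
    proof (rule barrier_algebra[OF F Fz Fw Fzw _ _ c(1) d cF])
      show "(F + t * Fw) * (Fyz + t * Fyzw) \<le> (Fy + t * Fyw) * (Fz + t * Fzw)" for t
        using rayleigh[of ?v ?z "corner 0 t"] j by (simp add: f_at sz gz g_at flip: g_def)
      show "(F + t * Fz) * (Fyw + t * Fyzw) \<le> (Fy + t * Fyz) * (Fw + t * Fzw)" for t
        using rayleigh[of ?v ?w "corner t 0"] j by (simp add: f_at sw gw g_at flip: g_def)
    qed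
    also have "Fy + d i * (Fyz + Fyw) + ((d i)^2 - c) * Fyzw = slope (pair_op 0 c i f) ?v y"
      using j by (simp add: slope_pair_op op[OF g, unfolded g_def] Fy_def Fyz_def Fyw_def Fyzw_def g_def)
    also have "Fy * (F + d i * (Fz + Fw) + ((d i)^2 - c) * Fzw) = Fy * N" by (simp add: N)
    also have "\<dots> \<le> (C j * F) * N"
      using \<open>N > 0\<close> slopeF[of j b] j by (intro mult_right_mono) (auto simp: Fy_def g_def)
    finally show ?thesis using F by (simp add: mult_ac)
  qed
  ultimately show ?thesis by (simp add: N_def)
qed

section \<open>Common interlacing\<close>

text \<open>If \<open>f\<close> had a zero beyond \<open>R\<close>, take \<open>- l\<close> to be the minimum of \<open>f / g\<close> on the half-line. Then
  \<open>f + l * g\<close> has a zero in \<open>Re z > R\<close> but is a limit of functions without zeros there, contradicting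
  Hurwitz's theorem.\<close>

lemma positive_beyond_of_common_interlacing:
  fixes f g :: "complex \<Rightarrow> complex"
  assumes hol: "f holomorphic_on UNIV" "g holomorphic_on UNIV"
    and real: "\<And>x::real. Im (f (of_real x)) = 0" "\<And>x::real. Im (g (of_real x)) = 0"
    and inf: "eventually (\<lambda>x::real. Re (f (of_real x)) > 0) at_top"
    and gpos: "\<And>x::real. x \<ge> R \<Longrightarrow> Re (g (of_real x)) > 0"
    and fR: "Re (f (of_real R)) > 0"
    and nz: "\<And>l z. l \<ge> 0 \<Longrightarrow> Im z \<noteq> 0 \<Longrightarrow> f z + of_real l * g z \<noteq> 0"
    and x: "x \<ge> R"
  shows "Re (f (of_real x)) > 0"
proof (rule ccontr)
  assume neg: "\<not> Re (f (of_real x)) > 0"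
  have cont: "isCont (\<lambda>t::real. Re (h (of_real t))) s" if "h holomorphic_on UNIV" for h :: "complex \<Rightarrow> complex" and s
  proof -
    have 1: "isCont complex_of_real s" by simp
    have 2: "isCont h (complex_of_real s)"
      using that holomorphic_on_imp_continuous_on continuous_on_eq_continuous_at open_UNIV by blast
    from isCont_o2[OF 1 2] show ?thesis by (rule isCont_Re)
  qed
  define phi where "phi t = Re (f (of_real t)) / Re (g (of_real t))" for t :: real
  obtain K where K: "\<And>t. t \<ge> K \<Longrightarrow> Re (f (of_real t)) > 0"
    using inf unfolding eventually_at_top_linorder by blast
  define b where "b = max K x"
  have "\<exists>y\<in>{R..b}. \<forall>t\<in>{R..b}. phi y \<le> phi t"
  proof (rule continuous_attains_inf)
    show "continuous_on {R..b} phi"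
      unfolding phi_def
    proof (rule continuous_at_imp_continuous_on, rule ballI)
      fix t assume "t \<in> {R..b}"
      then have "Re (g (of_real t)) \<noteq> 0" using gpos[of t] by simp
      with cont[OF hol(1), of t] cont[OF hol(2), of t]
      show "isCont (\<lambda>t. Re (f (of_real t)) / Re (g (of_real t))) t" by (rule isCont_divide)
    qed
  qed (use x in \<open>auto simp: b_def\<close>)
  then obtain y where y: "y \<in> {R..b}" and ymin: "\<And>t. t \<in> {R..b} \<Longrightarrow> phi y \<le> phi t" by blast
  have "phi x \<le> 0" using neg gpos[OF x] by (simp add: phi_def divide_nonpos_pos)
  then have y0: "phi y \<le> 0" using ymin[of x] x by (simp add: b_def)
  have ymin': "phi y \<le> phi t" if "t \<ge> R" for t
  proof (cases "t \<le> b")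
    case True then show ?thesis using ymin that by simp
  next
    case False
    then have "phi t > 0" using K[of t] gpos[OF that] by (simp add: phi_def b_def)
    then show ?thesis using y0 by simp
  qed
  have "phi R > 0" using fR gpos[of R] by (simp add: phi_def)
  then have yR: "y > R" using y y0 by (cases "y = R") auto
  define l where "l = - phi y"
  have l: "l \<ge> 0" using y0 by (simp add: l_def)
  define h where "h z = f z + of_real l * g z" for z
  have hhol: "h holomorphic_on UNIV" unfolding h_def by (intro holomorphic_intros hol)
  define S where "S = {z. Re z > R}"
  have "h (of_real y) \<noteq> 0"
  proof (rule Hurwitz_no_zeros[where S = S and g = h and \<F> = "\<lambda>n z. h z + of_real (1 / Suc n) * g z"])
    show "open S" unfolding S_def by (rule open_halfspace_Re_gt)
    show "connected S" unfolding S_def by (intro convex_connected convex_halfspace_Re_gt)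
    show "(\<lambda>z. h z + of_real (1 / Suc n) * g z) holomorphic_on S" for n
      by (intro holomorphic_intros holomorphic_on_subset[OF hhol] holomorphic_on_subset[OF hol(2)]) auto
    show "h holomorphic_on S" using hhol holomorphic_on_subset by blast
    show "uniform_limit T (\<lambda>n z. h z + of_real (1 / Suc n) * g z) h sequentially"
      if "compact T" "T \<subseteq> S" for T
    proof -
      have "compact (g ` T)"
        by (intro compact_continuous_image that(1) holomorphic_on_imp_continuous_on holomorphic_on_subset[OF hol(2)]) auto
      then have bnd: "bounded (g ` T)" by (rule compact_imp_bounded)
      then obtain M where M: "M > 0" "\<And>z. z \<in> T \<Longrightarrow> norm (g z) \<le> M"
        unfolding bounded_pos by blast
      show ?thesis
      proof (rule uniform_limitI)
        fix e :: real assume "e > 0"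
        then have "e / M > 0" using M by simp
        then have "eventually (\<lambda>n. inverse (real (Suc n)) < e / M) sequentially"
          by (intro order_tendstoD(2)[OF LIMSEQ_inverse_real_of_nat])
        then show "eventually (\<lambda>n. \<forall>z\<in>T. dist (h z + of_real (1 / Suc n) * g z) (h z) < e) sequentially"
        proof eventually_elim
          case (elim n)
          show ?case
          proof
            fix z assume "z \<in> T"
            have "dist (h z + of_real (1 / Suc n) * g z) (h z) = inverse (Suc n) * norm (g z)"
              by (simp add: dist_norm norm_mult norm_inverse inverse_eq_divide norm_divide del: of_nat_Suc)
            also have "\<dots> \<le> inverse (Suc n) * M" using M(2)[OF \<open>z \<in> T\<close>] by (intro mult_left_mono) auto
            also have "\<dots> < e" using elim M(1) by (simp add: pos_less_divide_eq)
            finally show "dist (h z + of_real (1 / Suc n) * g z) (h z) < e" .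
          qed
        qed
      qed
    qed
    show "\<not> h constant_on S"
    proof
      assume "h constant_on S"
      then obtain w where w: "\<And>z. z \<in> S \<Longrightarrow> h z = w" unfolding constant_on_def by blast
      have "Re (h (of_real y)) = 0" using gpos[of y] yR by (simp add: h_def l_def phi_def)
      then have w0: "Re w = 0" using w[of "of_real y"] yR by (simp add: S_def)
      \<comment> \<open>\<open>R\<close> is on the boundary of \<open>S\<close>, so positivity is
        carried to points of \<open>S\<close> by continuity from the right; it contradicts the zero
        real part at \<open>y\<close>.\<close>
      have "Re (h (of_real R)) > 0" using fR gpos[of R] l by (simp add: h_def add_pos_nonneg)
      moreover have "((\<lambda>t. Re (h (of_real t))) \<longlongrightarrow> Re (h (of_real R))) (at_right R)"
        using cont[OF hhol, of R] by (simp add: isCont_def filterlim_at_split)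
      ultimately have "eventually (\<lambda>t. Re (h (of_real t)) > 0) (at_right R)" by (rule order_tendstoD(1)[rotated])
      moreover have "eventually (\<lambda>t. t > R) (at_right R)" by (rule eventually_at_right_less)
      ultimately have "eventually (\<lambda>t. False) (at_right R)"
      proof eventually_elim
        case (elim t)
        then show False using w[of "of_real t"] w0 by (simp add: S_def)
      qed
      then show False by simp
    qed
    \<comment> \<open>Off the real axis this is \<open>nz\<close> for the multiplier
      \<open>l + 1 / Suc n\<close>; on it, minimality of \<open>phi y\<close> makes the real part
      positive.\<close>
    show "h z + of_real (1 / Suc n) * g z \<noteq> 0" if "z \<in> S" for n z
    proof (cases "Im z = 0")
      case False
      have "h z + of_real (1 / Suc n) * g z = f z + of_real (l + 1 / Suc n) * g z"
        by (simp add: h_def algebra_simps)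
      then show ?thesis using nz[of "l + 1 / Suc n" z] False l by simp
    next
      case True
      define t where "t = Re z"
      have z: "z = of_real t" and t: "t > R" using True that by (auto simp: t_def S_def complex_eq_iff)
      have "Re (f z) = phi t * Re (g z)" using gpos[of t] t by (simp add: phi_def z)
      then have "Re (h z + of_real (1 / Suc n) * g z) = (phi t - phi y + 1 / Suc n) * Re (g z)"
        by (simp add: h_def l_def algebra_simps)
      also have "\<dots> > 0" using ymin'[of t] gpos[of t] t z by (intro mult_pos_pos add_nonneg_pos) auto
      finally show ?thesis by (metis less_irrefl zero_complex.simps(1))
    qed
    show "of_real y \<in> S" using yR by (simp add: S_def)
  qed
  moreover have "h (of_real y) = 0"
    using gpos[of y] yR real[of y] by (simp add: h_def l_def phi_def complex_eq_iff)
  ultimately show False by simp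
qed

section \<open>Stable families\<close>

lemma iter_op_cong:
  "(\<And>j. 1 \<le> j \<Longrightarrow> j \<le> k \<Longrightarrow> m j = m' j \<and> c j = c' j) \<Longrightarrow> iter_op m c k f = iter_op m' c' k f"
  by (induction k) auto

text \<open>An expectation over \<open>X\<^sub>i\<close> sees the distribution of \<open>X\<^sub>i\<close> only through its first two moments.\<close>

lemma iter_op_moments:
  fixes f :: "(nat \<times> bool \<Rightarrow> 'a::comm_ring_1) \<Rightarrow> 'a"
  assumes f: "multiaffine f" and i: "1 \<le> i" "i \<le> n"
  shows "\<exists>A B C. \<forall>s t y. iter_op (m(i := s)) (c(i := t)) n f y = A y + s * B y - (s^2 + t) * C y"
  using i
proof (induction n)
  case (Suc k)
  show ?case
  proof (cases "i = Suc k")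
    case True
    define g where "g = iter_op m c k f"
    have g: "multiaffine g" unfolding g_def by (rule multiaffine_iter_op[OF f])
    have eq: "iter_op (m(i := s)) (c(i := t)) k f = g" for s t
      unfolding g_def by (rule iter_op_cong) (use True in auto)
    have *: "iter_op (m(i := s)) (c(i := t)) (Suc k) f y
        = g (y((i,True) := 0, (i,False) := 0))
        + s * (slope g (i,False) (y((i,True) := 0)) - slope g (i,True) (y((i,False) := 0)))
        - (s^2 + t) * slope (slope g (i,True)) (i,False) y" for s t y
      using multiaffine_shift2[OF g, of "(i,True)" "(i,False)" y 0 "- s" 0 s] True
      by (simp add: eq[unfolded True] pair_op_def algebra_simps power2_eq_square)
    show ?thesis by (intro exI allI) (rule *)
  next
    case False
    then obtain A B C where ABC: "\<And>s t y. iter_op (m(i := s)) (c(i := t)) k f y = A y + s * B y - (s^2 + t) * C y"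
      using Suc by fastforce
    have *: "iter_op (m(i := s)) (c(i := t)) (Suc k) f y
        = pair_op (m (Suc k)) (c (Suc k)) (Suc k) A y + s * pair_op (m (Suc k)) (c (Suc k)) (Suc k) B y
        - (s^2 + t) * pair_op (m (Suc k)) (c (Suc k)) (Suc k) C y" for s t y
      using False by (simp add: pair_op_def slope_def ABC algebra_simps)
    show ?thesis by (intro exI allI) (rule *)
  qed
qed simp

lemma iter_op_zero_variance:
  "iter_op m (\<lambda>_. 0) n f y
    = f (\<lambda>(i, b). if 1 \<le> i \<and> i \<le> n then (if b then - m i else m i) else y (i, b))"
proof (induction n arbitrary: y)
  case (Suc n)
  show ?case
    by (simp add: pair_op_def Suc) (rule arg_cong[where f = f], auto simp: fun_eq_iff le_Suc_eq)
qed (auto intro!: arg_cong[where f = f])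

text \<open>These are the properties of the product of two determinants on which the averaging
  rests. By \<open>growth_P\<close>, \<open>P\<close> behaves at infinity like a monic polynomial of
  degree \<open>D\<close> in \<open>x\<close>.\<close>

locale stable_family =
  fixes P :: "complex \<Rightarrow> (nat \<times> bool \<Rightarrow> complex) \<Rightarrow> complex" and D :: nat
  assumes multiaffine_P: "multiaffine (P x)"
    and P_nonzero: "Im x > 0 \<Longrightarrow> (\<And>v. Im (y v) \<ge> 0) \<Longrightarrow> P x y \<noteq> 0"
    and holomorphic_P: "(\<lambda>x. P x y) holomorphic_on UNIV"
    and cnj_P: "cnj (P x y) = P (cnj x) (\<lambda>v. cnj (y v))"
    and growth_P: "((\<lambda>x::real. P (of_real x) y / of_real x ^ D) \<longlongrightarrow> 1) at_top"
begin

text \<open>A variable already fixed to \<open>e\<close> is encoded by mean \<open>e\<close> and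
  variance 0, so fixed and averaged variables are treated alike.\<close>

definition Q :: "(nat \<Rightarrow> real) \<Rightarrow> (nat \<Rightarrow> real) \<Rightarrow> nat \<Rightarrow> complex \<Rightarrow> (nat \<times> bool \<Rightarrow> complex) \<Rightarrow> complex" where
  "Q m c k x = iter_op (\<lambda>i. of_real (m i)) (\<lambda>i. of_real (c i)) k (P x)"

lemma Q_0 [simp]: "Q m c 0 x = P x"
  by (simp add: Q_def)

lemma Q_Suc: "Q m c (Suc k) x = pair_op (of_real (m (Suc k))) (of_real (c (Suc k))) (Suc k) (Q m c k x)"
  by (simp add: Q_def)

lemma multiaffine_Q: "multiaffine (Q m c k x)"
  unfolding Q_def by (rule multiaffine_iter_op[OF multiaffine_P])

lemma holomorphic_Q: "(\<lambda>x. Q m c k x y) holomorphic_on UNIV"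
proof (induction k arbitrary: y)
  case (Suc k)
  show ?case unfolding Q_Suc pair_op_def slope_def by (intro holomorphic_intros Suc)
qed (simp add: holomorphic_P)

lemma cnj_Q: "cnj (Q m c k x y) = Q m c k (cnj x) (\<lambda>v. cnj (y v))"
proof (induction k arbitrary: y)
  case (Suc k)
  have *: "(\<lambda>v. cnj ((y(w := t)) v)) = (\<lambda>v. cnj (y v))(w := cnj t)" for y :: "nat \<times> bool \<Rightarrow> complex" and w t
    by auto
  show ?case unfolding Q_Suc pair_op_def slope_def by (simp add: Suc * del: fun_upd_apply)
qed (simp add: cnj_P)

text \<open>The second difference has limit \<open>(1 - 1) - (1 - 1)\<close>, so averaging preserves
  the leading term.\<close>

lemma Q_growth: "((\<lambda>x::real. Q m c k (of_real x) y / of_real x ^ D) \<longlongrightarrow> 1) at_top"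
proof (induction k arbitrary: y)
  case (Suc k)
  let ?q = "\<lambda>y (x::real). Q m c k (of_real x) y / of_real x ^ D"
  let ?z = "(Suc k, True)" and ?w = "(Suc k, False)"
  have "((\<lambda>x. ?q (y(?z := - of_real (m (Suc k)), ?w := of_real (m (Suc k)))) x
      - of_real (c (Suc k)) * ((?q (y(?w := 1, ?z := 1)) x - ?q (y(?w := 1, ?z := 0)) x)
        - (?q (y(?w := 0, ?z := 1)) x - ?q (y(?w := 0, ?z := 0)) x)))
      \<longlongrightarrow> 1 - of_real (c (Suc k)) * ((1 - 1) - (1 - 1))) at_top"
    by (intro tendsto_intros Suc)
  then show ?case
    by (simp add: Q_Suc pair_op_def slope_def diff_divide_distrib right_diff_distrib)
qed (simp add: growth_P)

lemma Q_nonzero: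
  assumes "\<And>i. c i \<ge> 0" "Im x > 0" "\<And>v. Im (y v) \<ge> 0"
  shows "Q m c k x y \<noteq> 0"
  unfolding Q_def
  by (rule iter_op_nonzero[OF multiaffine_P]) (use assms P_nonzero in auto)

lemma Q_real_rooted:
  assumes "\<And>i. c i \<ge> 0" "Im x \<noteq> 0"
  shows "Q m c k x (\<lambda>v. of_real (y v)) \<noteq> 0"
proof (cases "Im x > 0")
  case True then show ?thesis using assms by (intro Q_nonzero) auto
next
  case False
  have "Q m c k (cnj x) (\<lambda>v. of_real (y v)) \<noteq> 0" using assms False by (intro Q_nonzero) auto
  then show ?thesis using cnj_Q[of m c k x "\<lambda>v. of_real (y v)"] by auto
qed

section \<open>Averages at real points and the barrier\<close>

definition Qr :: "(nat \<Rightarrow> real) \<Rightarrow> (nat \<Rightarrow> real) \<Rightarrow> nat \<Rightarrow> real \<Rightarrow> (nat \<times> bool \<Rightarrow> real) \<Rightarrow> real" where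
  "Qr m c k x y = Re (Q m c k (of_real x) (\<lambda>v. of_real (y v)))"

lemma of_real_Qr: "of_real (Qr m c k x y) = Q m c k (of_real x) (\<lambda>v. of_real (y v))"
proof -
  have "cnj (Q m c k (of_real x) (\<lambda>v. of_real (y v))) = Q m c k (of_real x) (\<lambda>v. of_real (y v))"
    by (simp add: cnj_Q)
  then have "Im (Q m c k (of_real x) (\<lambda>v. of_real (y v))) = 0"
    by (metis Reals_cnj_iff complex_is_Real_iff)
  then show ?thesis by (simp add: Qr_def complex_eq_iff)
qed

lemma multiaffine_Qr: "multiaffine (Qr m c k x)"
  by (rule multiaffine_of_real[OF of_real_Qr multiaffine_Q])

lemma Qr_Suc: "Qr m c (Suc k) x = pair_op (m (Suc k)) (c (Suc k)) (Suc k) (Qr m c k x)"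
proof
  fix y
  have eq: "Qr m c k x y = iter_op m c k (Qr m c 0 x) y" for k y
  proof -
    have "complex_of_real (iter_op m c k (Qr m c 0 x) y) = of_real (Qr m c k x y)"
      unfolding of_real_Qr Q_def[of m c k] by (rule iter_op_of_real) (simp add: of_real_Qr)
    then show ?thesis by (simp only: of_real_eq_iff)
  qed
  then have "Qr m c k x = iter_op m c k (Qr m c 0 x)" by blast
  then show "Qr m c (Suc k) x y = pair_op (m (Suc k)) (c (Suc k)) (Suc k) (Qr m c k x) y"
    using eq[of "Suc k" y] by simp
qed

text \<open>The real point \<open>x\<close> is approached along \<open>x + \<i> * s\<close> with
  \<open>s\<close> decreasing to 0. There stability excludes zeros, even after moving the
  coordinates \<open>v\<close> and \<open>v'\<close> into the closed upper half-plane.\<close>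

lemma rayleigh_Qr:
  assumes c: "\<And>i. c i \<ge> 0" and v: "v \<noteq> v'"
  shows "Qr m c k x y * slope (slope (Qr m c k x) v) v' y \<le> slope (Qr m c k x) v y * slope (Qr m c k x) v' y"
proof -
  let ?y = "\<lambda>v. complex_of_real (y v)"
  let ?Q = "\<lambda>s. Q m c k (of_real x + \<i> * of_real s)"
  have cont: "isCont (\<lambda>s. ?Q s y) 0" for y
  proof -
    have 1: "isCont (\<lambda>s. complex_of_real x + \<i> * of_real s) 0" by (intro continuous_intros)
    have 2: "isCont (\<lambda>x. Q m c k x y) (complex_of_real x + \<i> * of_real 0)"
      using holomorphic_on_imp_continuous_on[OF holomorphic_Q] continuous_on_eq_continuous_at open_UNIV by blast
    show ?thesis by (rule isCont_o2[OF 1 2])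
  qed
  show ?thesis
  proof (rule rayleigh_limit)
    show "isCont (\<lambda>s. ?Q s ?y) 0" by (rule cont)
    show "isCont (\<lambda>s. slope (?Q s) v ?y) 0" "isCont (\<lambda>s. slope (?Q s) v' ?y) 0"
      "isCont (\<lambda>s. slope (slope (?Q s) v) v' ?y) 0"
      unfolding slope_def by (intro continuous_intros cont)+
    show "?Q s ?y + a * slope (?Q s) v ?y + b * slope (?Q s) v' ?y + a * b * slope (slope (?Q s) v) v' ?y \<noteq> 0"
      if "s > 0" "Im a \<ge> 0" "Im b \<ge> 0" for s a b
    proof -
      have "?Q s (?y(v := ?y v + a, v' := ?y v' + b)) \<noteq> 0"
        using that c by (intro Q_nonzero) auto
      then show ?thesis
        unfolding multiaffine_shift2[OF multiaffine_Q v] using v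
        by (metis fun_upd_triv)
    qed
    have 1: "complex_of_real (slope (Qr m c k x) v y) = slope (Q m c k (of_real x)) v (\<lambda>w. of_real (y w))" for v y
      by (rule slope_of_real) (rule of_real_Qr)
    show "?Q 0 ?y = of_real (Qr m c k x y)" by (simp add: of_real_Qr)
    show "slope (?Q 0) v ?y = of_real (slope (Qr m c k x) v y)" by (simp add: 1)
    show "slope (?Q 0) v' ?y = of_real (slope (Qr m c k x) v' y)" by (simp add: 1)
    have "complex_of_real (slope (slope (Qr m c k x) v) v' y) = slope (slope (Q m c k (of_real x)) v) v' ?y"
      by (rule slope_of_real) (rule 1)
    then show "slope (slope (?Q 0) v) v' ?y = of_real (slope (slope (Qr m c k x) v) v' y)" by simp
  qed
qed

text \<open>By \<open>barrier_step\<close> the invariant survives each average, with constraints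
  left only on the pairs not yet averaged. The origin satisfies them because \<open>d\<close> is
  nonnegative.\<close>

lemma barrier:
  fixes d C :: "nat \<Rightarrow> real"
  assumes c: "\<And>i. c i \<ge> 0" and d: "\<And>i. d i \<ge> 0" and cd: "\<And>i. c i * (2 * C i) \<le> d i"
    and pos: "\<And>y. (\<And>j b. j \<ge> 1 \<Longrightarrow> y (j, b) \<ge> - d j) \<Longrightarrow> Qr (\<lambda>_. 0) c 0 x y > 0"
    and slopes: "\<And>y j b. (\<And>j b. j \<ge> 1 \<Longrightarrow> y (j, b) \<ge> - d j) \<Longrightarrow> j \<ge> 1
       \<Longrightarrow> slope (Qr (\<lambda>_. 0) c 0 x) (j, b) y \<le> C j * Qr (\<lambda>_. 0) c 0 x y"
  shows "Qr (\<lambda>_. 0) c n x (\<lambda>_. 0) > 0"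
proof -
  let ?q = "\<lambda>k. Qr (\<lambda>_. 0) c k x"
  have step: "(\<forall>j>k. \<forall>b. y (j, b) \<ge> - d j) \<longrightarrow> ?q k y > 0 \<and> (\<forall>j>k. \<forall>b. slope (?q k) (j, b) y \<le> C j * ?q k y)" for k y
  proof (induction k arbitrary: y)
    case 0
    show ?case using pos[of y] slopes[of y] by auto
  next
    case (Suc k)
    show ?case
    proof
      assume y: "\<forall>j>Suc k. \<forall>b. y (j, b) \<ge> - d j"
      show "?q (Suc k) y > 0 \<and> (\<forall>j>Suc k. \<forall>b. slope (?q (Suc k)) (j, b) y \<le> C j * ?q (Suc k) y)"
        unfolding Qr_Suc
      proof (rule barrier_step[where d = d])
        show "multiaffine (?q k)" by (rule multiaffine_Qr)
        show "?q k y * slope (slope (?q k) v) v' y \<le> slope (?q k) v y * slope (?q k) v' y" if "v \<noteq> v'" for v v' y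
          by (rule rayleigh_Qr[OF c that])
      qed (use Suc.IH c d cd y Suc_le_eq in auto)
    qed
  qed
  show ?thesis using step[of n "\<lambda>_. 0"] d by simp
qed

section \<open>Fixing the variables one at a time\<close>

lemma Qr_eventually_pos: "eventually (\<lambda>x. Qr m c k x y > 0) at_top"
proof -
  have "((\<lambda>x. Re (Q m c k (of_real x) (\<lambda>v. of_real (y v)) / of_real x ^ D)) \<longlongrightarrow> Re 1) at_top"
    by (intro tendsto_Re Q_growth)
  moreover have "Re (Q m c k (of_real x) (\<lambda>v. of_real (y v)) / of_real x ^ D) = Qr m c k x y / x ^ D" for x
    by (metis Qr_def Re_divide_of_real of_real_power)
  ultimately have "((\<lambda>x. Qr m c k x y / x ^ D) \<longlongrightarrow> 1) at_top" by simp
  then have "eventually (\<lambda>x. Qr m c k x y / x ^ D > 0) at_top" by (rule order_tendstoD(1)) simp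
  then show ?thesis using eventually_gt_at_top[of 0]
  proof eventually_elim
    case (elim x)
    then show ?case by (simp add: zero_less_divide_iff zero_less_power)
  qed
qed

text \<open>The average is positive just beyond \<open>R\<close>, so some \<open>e\<close> gives a
  positive value there. Adding a nonnegative multiple of the average to that choice gives, up to a
  factor, another average and hence no nonreal zeros, so positivity spreads along the
  half-line.\<close>

lemma select_one:
  fixes p :: "real \<Rightarrow> real"
  assumes c: "\<And>j. c j \<ge> 0" and i: "1 \<le> i" "i \<le> n" and mi: "m i = 0"
    and I: "finite I" and p: "\<And>e. e \<in> I \<Longrightarrow> p e \<ge> 0" "(\<Sum>e\<in>I. p e) = 1"
    and mean: "(\<Sum>e\<in>I. p e * e) = 0" and var: "(\<Sum>e\<in>I. p e * e^2) = c i"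
    and pos: "\<And>x. x > R \<Longrightarrow> Qr m c n x y > 0"
  shows "\<exists>e\<in>I. \<forall>x>R. Qr (m(i := e)) (c(i := 0)) n x y > 0"
proof (rule ccontr)
  assume "\<not> ?thesis"
  then obtain X where X: "\<And>e. e \<in> I \<Longrightarrow> X e > R" "\<And>e. e \<in> I \<Longrightarrow> \<not> Qr (m(i := e)) (c(i := 0)) n (X e) y > 0"
    by metis
  have "I \<noteq> {}" using p(2) by auto
  \<comment> \<open>A single point below every failure point \<open>X e\<close>, so that whichever
    \<open>e\<close> is positive at \<open>R'\<close> contradicts its own
    \<open>X e\<close>.\<close>
  define R' where "R' = (R + Min (X ` I)) / 2"
  have "Min (X ` I) > R" using X(1) I \<open>I \<noteq> {}\<close> by simp
  then have R': "R' > R" "R' < Min (X ` I)" by (simp_all add: R'_def)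
  have R'X: "R' < X e" if "e \<in> I" for e
  proof -
    have "Min (X ` I) \<le> X e" using that I by simp
    then show ?thesis using R' by simp
  qed
  \<comment> \<open>The dependence is affine in the mean \<open>s\<close> and the second moment
    \<open>s^2 + t\<close>, so mixing distributions mixes the values.\<close>
  have moments: "\<exists>A B C. \<forall>s t. Q (m(i := s)) (c(i := t)) n x (\<lambda>v. of_real (y v))
      = A + of_real s * B - of_real (s^2 + t) * C" for x
  proof -
    obtain A B C where *: "\<And>s t y. iter_op ((\<lambda>j. of_real (m j))(i := s)) ((\<lambda>j. of_real (c j))(i := t)) n (P x) y
        = A y + s * B y - (s^2 + t) * C y"
      using iter_op_moments[OF multiaffine_P i] by metis
    have upd: "(\<lambda>j. complex_of_real ((h(i := s)) j)) = (\<lambda>j. of_real (h j))(i := of_real s)" for h and s :: real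
      by auto
    show ?thesis unfolding Q_def upd * by auto
  qed
  let ?Q = "\<lambda>s t x. Q (m(i := s)) (c(i := t)) n x (\<lambda>v. of_real (y v))"
  have mi': "m(i := 0) = m" "c(i := c i) = c" using mi by auto
  have "(\<Sum>e\<in>I. p e * Qr (m(i := e)) (c(i := 0)) n R' y) = Qr m c n R' y"
  proof -
    obtain A B C where *: "\<And>s t. ?Q s t (of_real R') = A + of_real s * B - of_real (s^2 + t) * C"
      using moments by metis
    have "complex_of_real (\<Sum>e\<in>I. p e * Qr (m(i := e)) (c(i := 0)) n R' y)
        = (\<Sum>e\<in>I. of_real (p e) * A + of_real (p e * e) * B - of_real (p e * e^2) * C)"
      by (simp add: of_real_Qr * algebra_simps)
    also have "\<dots> = of_real (\<Sum>e\<in>I. p e) * A + of_real (\<Sum>e\<in>I. p e * e) * B - of_real (\<Sum>e\<in>I. p e * e^2) * C"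
      by (simp only: of_real_sum sum_distrib_right sum.distrib sum_subtractf)
    also have "\<dots> = of_real (Qr m c n R' y)"
      using *[of 0 "c i"] by (simp add: p mean var mi' of_real_Qr)
    finally show ?thesis by (simp only: of_real_eq_iff)
  qed
  also have "\<dots> > 0" using pos R' by simp
  finally obtain e where e: "e \<in> I" "p e * Qr (m(i := e)) (c(i := 0)) n R' y > 0"
    by (metis (no_types, lifting) not_less sum_nonpos)
  then have eR': "Qr (m(i := e)) (c(i := 0)) n R' y > 0" using p(1)[OF e(1)] by (simp add: zero_less_mult_iff)
  have "Re (?Q e 0 (of_real (X e))) > 0"
  proof (rule positive_beyond_of_common_interlacing)
    show "(\<lambda>x. ?Q e 0 x) holomorphic_on UNIV" "(\<lambda>x. ?Q 0 (c i) x) holomorphic_on UNIV"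
      by (rule holomorphic_Q)+
    show "Im (?Q e 0 (of_real x)) = 0" "Im (?Q 0 (c i) (of_real x)) = 0" for x
      by (simp_all flip: of_real_Qr)
    show "eventually (\<lambda>x. Re (?Q e 0 (of_real x)) > 0) at_top"
      using Qr_eventually_pos by (simp add: Qr_def)
    show "Re (?Q 0 (c i) (of_real x)) > 0" if "x \<ge> R'" for x
      using pos[of x] that R' by (simp add: mi' Qr_def)
    show "Re (?Q e 0 (of_real R')) > 0" using eR' by (simp add: Qr_def)
    show "X e \<ge> R'" using R'X[OF e(1)] by simp
    show "?Q e 0 z + of_real l * ?Q 0 (c i) z \<noteq> 0" if l: "l \<ge> 0" and z: "Im z \<noteq> 0" for l z
    proof -
      obtain A B C where *: "\<And>s t. ?Q s t z = A + of_real s * B - of_real (s^2 + t) * C"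
        using moments by metis
      \<comment> \<open>Mean and variance of the mixture with weights \<open>1 / (1 + l)\<close> for
        the constant \<open>e\<close> and \<open>l / (1 + l)\<close> for the centred variable of
        variance \<open>c i\<close>.\<close>
      define s t where "s = e / (1 + l)" and "t = (e^2 + l * c i) / (1 + l) - s^2"
      have l1: "1 + l > 0" using l by simp
      have "s^2 = e^2 / (1 + l) / (1 + l)" by (simp add: s_def power_divide power2_eq_square)
      also have "\<dots> \<le> e^2 / (1 + l)" using divide_left_mono[of 1 "1 + l" "e^2 / (1 + l)"] l by simp
      also have "\<dots> \<le> (e^2 + l * c i) / (1 + l)" using l c by (intro divide_right_mono) auto
      finally have t: "t \<ge> 0" by (simp add: t_def)
      have "of_real (1 + l) * ?Q s t z = of_real (1 + l) * A + of_real ((1 + l) * s) * B - of_real ((1 + l) * (s^2 + t)) * C"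
        unfolding * by (simp add: algebra_simps)
      also have "(1 + l) * s = e" using l1 by (simp add: s_def)
      also have "(1 + l) * (s^2 + t) = e^2 + l * c i" using l1 by (simp add: t_def)
      also have "of_real (1 + l) * A + of_real e * B - of_real (e^2 + l * c i) * C = ?Q e 0 z + of_real l * ?Q 0 (c i) z"
        unfolding * by (simp add: algebra_simps)
      finally have eq: "?Q e 0 z + of_real l * ?Q 0 (c i) z = of_real (1 + l) * ?Q s t z" ..
      have "?Q s t z \<noteq> 0" using t c z by (intro Q_real_rooted) auto
      then show ?thesis unfolding eq using l1 by (metis less_irrefl mult_eq_0_iff of_real_eq_0_iff)
    qed
  qed
  then show False using X(2)[OF e(1)] by (simp add: Qr_def)
qed

lemma select_all:
  fixes p :: "nat \<Rightarrow> real \<Rightarrow> real" and I :: "nat \<Rightarrow> real set"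
  assumes c: "\<And>j. c j \<ge> 0"
    and I: "\<And>i. i \<in> {1..n} \<Longrightarrow> finite (I i)"
    and p: "\<And>i e. i \<in> {1..n} \<Longrightarrow> e \<in> I i \<Longrightarrow> p i e \<ge> 0" "\<And>i. i \<in> {1..n} \<Longrightarrow> (\<Sum>e\<in>I i. p i e) = 1"
    and mean: "\<And>i. i \<in> {1..n} \<Longrightarrow> (\<Sum>e\<in>I i. p i e * e) = 0"
    and var: "\<And>i. i \<in> {1..n} \<Longrightarrow> (\<Sum>e\<in>I i. p i e * e^2) = c i"
    and pos: "\<And>x. x > R \<Longrightarrow> Qr (\<lambda>_. 0) c n x y > 0"
  shows "\<exists>e. (\<forall>i\<in>{1..n}. e i \<in> I i) \<and> (\<forall>x>R. Qr e (\<lambda>_. 0) n x y > 0)"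
proof -
  \<comment> \<open>The first \<open>k\<close> variables are fixed, with variance 0; the others are
    still averaged with mean 0.\<close>
  have "k \<le> n \<Longrightarrow> \<exists>e. (\<forall>i\<in>{1..k}. e i \<in> I i)
      \<and> (\<forall>x>R. Qr (\<lambda>i. if 1 \<le> i \<and> i \<le> k then e i else 0) (\<lambda>i. if 1 \<le> i \<and> i \<le> k then 0 else c i) n x y > 0)" for k
  proof (induction k)
    case 0
    have "(\<lambda>i::nat. if 1 \<le> i \<and> i \<le> 0 then a i else b i) = b" for a b :: "nat \<Rightarrow> real" by auto
    then show ?case using pos by simp
  next
    case (Suc k)
    then obtain e where e: "\<forall>i\<in>{1..k}. e i \<in> I i"
      "\<forall>x>R. Qr (\<lambda>i. if 1 \<le> i \<and> i \<le> k then e i else 0) (\<lambda>i. if 1 \<le> i \<and> i \<le> k then 0 else c i) n x y > 0" (is "\<forall>x>R. Qr ?m ?c n x y > 0")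
      by auto
    have "\<exists>e\<in>I (Suc k). \<forall>x>R. Qr (?m(Suc k := e)) (?c(Suc k := 0)) n x y > 0"
      by (rule select_one[where p = "p (Suc k)"])
        (use Suc.prems I p mean var c e(2) in auto)
    then obtain e' where e': "e' \<in> I (Suc k)" "\<forall>x>R. Qr (?m(Suc k := e')) (?c(Suc k := 0)) n x y > 0" by blast
    have "?m(Suc k := e') = (\<lambda>i. if 1 \<le> i \<and> i \<le> Suc k then (e(Suc k := e')) i else 0)"
      "?c(Suc k := 0) = (\<lambda>i. if 1 \<le> i \<and> i \<le> Suc k then 0 else c i)"
      by (auto simp: fun_eq_iff le_Suc_eq)
    then show ?case using e(1) e' by (intro exI[of _ "e(Suc k := e')"]) (auto simp: le_Suc_eq)
  qed
  from this[of n] obtain e where e: "\<forall>i\<in>{1..n}. e i \<in> I i"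
    "\<forall>x>R. Qr (\<lambda>i. if 1 \<le> i \<and> i \<le> n then e i else 0) (\<lambda>i. if 1 \<le> i \<and> i \<le> n then 0 else c i) n x y > 0" by auto
  have "Qr (\<lambda>i. if 1 \<le> i \<and> i \<le> n then e i else 0) (\<lambda>i. if 1 \<le> i \<and> i \<le> n then 0 else c i) n x y
      = Qr e (\<lambda>_. 0) n x y" for x
    unfolding Qr_def Q_def by (intro arg_cong[where f = Re] fun_cong[OF iter_op_cong]) auto
  then show ?thesis using e by auto
qed

end

section \<open>Hermitian pencils of rank one matrices\<close>

definition cip :: "complex ^ 'd \<Rightarrow> complex ^ 'd \<Rightarrow> complex" where
  "cip u x = (\<Sum>j\<in>UNIV. cnj (u $ j) * x $ j)"

lemma outer_mult_vec: "outer u *v x = cip u x *s u"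
  by (simp add: vec_eq_iff matrix_vector_mult_def outer_def cip_def sum_distrib_left sum_distrib_right mult_ac)

lemma cip_add_right: "cip u (x + y) = cip u x + cip u y"
  by (simp add: cip_def sum.distrib algebra_simps)

lemma cip_smult_right: "cip u (c *s x) = c * cip u x"
  by (simp add: cip_def sum_distrib_left mult_ac)

lemma cip_zero_right [simp]: "cip u 0 = 0"
  by (simp add: cip_def)

lemma cip_sum_right: "cip u (\<Sum>k\<in>K. f k) = (\<Sum>k\<in>K. cip u (f k))"
  by (induction K rule: infinite_finite_induct) (auto simp: cip_add_right)

lemma cnj_cip: "cnj (cip x y) = cip y x"
  by (simp add: cip_def mult.commute)

lemma inner_eq_Re_cip: "inner x y = Re (cip x y)"
  by (simp add: inner_vec_def cip_def inner_complex_def)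

lemma cip_self: "cip x x = of_real ((norm x)^2)"
proof -
  have "Im (cip x x) = 0" using cnj_cip[of x x] by (metis Reals_cnj_iff complex_is_Real_iff)
  then show ?thesis by (simp add: complex_eq_iff inner_eq_Re_cip power2_norm_eq_inner)
qed

lemma cip_mult_flip: "cip u y * cip y u = of_real ((cmod (cip u y))^2)"
  by (metis cnj_cip complex_norm_square)

lemma cmod_cip_le: "(cmod (cip u y))^2 \<le> (norm u)^2 * (norm y)^2"
proof -
  have "(cmod (cip u y))^2 = Re (cip y (cip u y *s u))"
    by (simp add: cip_smult_right cip_mult_flip)
  also have "\<dots> \<le> norm y * norm (cip u y *s u)"
    unfolding inner_eq_Re_cip[symmetric] by (rule norm_cauchy_schwarz)
  also have "norm (cip u y *s u) = cmod (cip u y) * norm u"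
    by (simp add: norm_vec_def L2_set_def norm_mult power_mult_distrib sum_distrib_left[symmetric] real_sqrt_mult)
  finally have *: "cmod (cip u y) * cmod (cip u y) \<le> cmod (cip u y) * (norm u * norm y)"
    by (simp add: power2_eq_square mult_ac)
  have "cmod (cip u y) \<le> norm u * norm y"
    using * by (cases "cip u y = 0") auto
  then show ?thesis by (metis norm_ge_zero power_mono power_mult_distrib)
qed

text \<open>Entrywise form of \<open>x\<close> times the identity plus the sum of \<open>z k\<close>
  times \<open>outer (u k)\<close>. With \<open>x = 0\<close> it is the matrix whose norm is to be
  bounded.\<close>

definition pencil :: "(nat \<Rightarrow> complex ^ 'd) \<Rightarrow> nat \<Rightarrow> complex \<Rightarrow> (nat \<Rightarrow> complex) \<Rightarrow> complex ^ 'd ^ 'd" where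
  "pencil u n x z = (\<chi> i j. (if i = j then x else 0) + (\<Sum>k=1..n. z k * (u k $ i * cnj (u k $ j))))"

lemma pencil_mult_vec: "pencil u n x z *v y = x *s y + (\<Sum>k=1..n. (z k * cip (u k) y) *s u k)"
proof -
  have 1: "(\<Sum>j\<in>UNIV. (if i = j then x else 0) * y $ j) = x * y $ i" for i
    by (simp add: if_distrib[of "\<lambda>a. a * _"] cong: if_cong)
  have 2: "(\<Sum>j\<in>UNIV. (\<Sum>k=1..n. z k * (u k $ i * cnj (u k $ j))) * y $ j)
      = (\<Sum>k=1..n. z k * cip (u k) y * u k $ i)" for i
    unfolding sum_distrib_right by (subst sum.swap) (simp add: cip_def sum_distrib_left sum_distrib_right mult_ac)
  show ?thesis
    by (simp add: vec_eq_iff matrix_vector_mult_def pencil_def distrib_right sum.distrib 1 2 del: One_nat_def)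
qed

lemma cip_pencil:
  "cip y (pencil u n x z *v y) = x * of_real ((norm y)^2) + (\<Sum>k=1..n. z k * of_real ((cmod (cip (u k) y))^2))"
  by (simp add: pencil_mult_vec cip_add_right cip_sum_right cip_smult_right cip_self mult.assoc cip_mult_flip)

section \<open>Determinants of pencils\<close>

lemma det_nonzero_iff_ker: "det A \<noteq> 0 \<longleftrightarrow> (\<forall>x. A *v x = 0 \<longrightarrow> x = 0)" for A :: "complex ^ 'd ^ 'd"
  by (metis invertible_det_nz invertible_left_inverse matrix_left_invertible_ker)

text \<open>For a kernel vector \<open>y\<close> the form \<open>cip_pencil\<close> vanishes, but
  its imaginary part is \<open>Im x * (norm y)^2\<close> plus nonnegative terms.\<close>

lemma det_pencil_nonzero:
  assumes "Im x > 0" "\<And>k. Im (z k) \<ge> 0"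
  shows "det (pencil u n x z) \<noteq> 0"
  unfolding det_nonzero_iff_ker
proof (intro allI impI)
  fix y assume "pencil u n x z *v y = 0"
  then have "Im (cip y (pencil u n x z *v y)) = 0" by simp
  then have "Im x * (norm y)^2 + (\<Sum>k=1..n. Im (z k) * (cmod (cip (u k) y))^2) = 0"
    unfolding cip_pencil by (simp del: of_real_power)
  moreover have "(\<Sum>k=1..n. Im (z k) * (cmod (cip (u k) y))^2) \<ge> 0"
    using assms(2) by (intro sum_nonneg) auto
  moreover have "Im x * (norm y)^2 \<ge> 0" using assms(1) by auto
  ultimately have "Im x * (norm y)^2 = 0" by linarith
  then show "y = 0" using assms(1) by simp
qed

text \<open>Each rank one matrix is Hermitian, so conjugating the entries amounts to transposing and
  conjugating the coefficients.\<close>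

lemma cnj_det_pencil: "cnj (det (pencil u n x z)) = det (pencil u n (cnj x) (\<lambda>k. cnj (z k)))"
proof -
  have "cnj (det (pencil u n x z)) = det (\<chi> i j. cnj (pencil u n x z $ i $ j))"
    by (simp add: det_def)
  also have "(\<chi> i j. cnj (pencil u n x z $ i $ j)) = transpose (pencil u n (cnj x) (\<lambda>k. cnj (z k)))"
    by (auto simp: vec_eq_iff pencil_def transpose_def mult_ac)
  finally show ?thesis by simp
qed

lemma det_pencil_real: "det (pencil u n (of_real x) (\<lambda>k. of_real (z k))) \<in> \<real>"
  using cnj_det_pencil[of u n "of_real x" "\<lambda>k. of_real (z k)"] by (simp add: Reals_cnj_iff)

lemma holomorphic_det_pencil: "(\<lambda>x. det (pencil u n x z)) holomorphic_on S"
proof -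
  have *: "(\<lambda>x. (if i = j then x else 0) + c) holomorphic_on S" for i j :: 'd and c :: complex
    by (cases "i = j") (auto intro!: holomorphic_intros)
  show ?thesis unfolding det_def pencil_def vec_lambda_beta by (intro holomorphic_intros *)
qed

lemma det_pencil_zero [simp]: "det (pencil u n 1 (\<lambda>k. 0)) = 1"
proof -
  have "pencil u n 1 (\<lambda>k. 0) = mat 1" by (simp add: pencil_def mat_def vec_eq_iff)
  then show ?thesis by simp
qed

lemma tendsto_det_pencil:
  fixes u :: "nat \<Rightarrow> complex ^ 'd"
  assumes "(X \<longlongrightarrow> x) F" "\<And>k. ((\<lambda>t. Z t k) \<longlongrightarrow> z k) F"
  shows "((\<lambda>t. det (pencil u n (X t) (Z t))) \<longlongrightarrow> det (pencil u n x z)) F"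
proof -
  have *: "((\<lambda>t. if i = j then X t else 0) \<longlongrightarrow> (if i = j then x else 0)) F" for i j :: 'd
    using assms by auto
  show ?thesis unfolding det_def pencil_def vec_lambda_beta by (intro tendsto_intros * assms)
qed

text \<open>Dividing every row by \<open>x\<close> turns the quotient into the determinant of a
  pencil that tends to the identity.\<close>

lemma det_pencil_growth:
  fixes u :: "nat \<Rightarrow> complex ^ 'd"
  shows "((\<lambda>x::real. det (pencil u n (of_real x) z) / of_real x ^ CARD('d)) \<longlongrightarrow> 1) at_top"
proof -
  have "((\<lambda>x. det (pencil u n 1 (\<lambda>k. z k / of_real x))) \<longlongrightarrow> det (pencil u n 1 (\<lambda>k. 0))) at_top"
    by (intro tendsto_det_pencil tendsto_const tendsto_divide_0[OF tendsto_const] filterlim_of_real_at_infinity)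
  moreover have "eventually (\<lambda>x::real. det (pencil u n 1 (\<lambda>k. z k / of_real x))
      = det (pencil u n (of_real x) z) / of_real x ^ CARD('d)) at_top"
    using eventually_gt_at_top[of 0]
  proof eventually_elim
    case (elim x)
    have "pencil u n 1 (\<lambda>k. z k / of_real x) $ i $ j = pencil u n (of_real x) z $ i $ j / of_real x" for i j
      using elim by (simp add: pencil_def add_divide_distrib sum_divide_distrib)
    then show ?case
      unfolding det_def by (simp add: prod_dividef sum_divide_distrib)
  qed
  ultimately show ?thesis by (simp add: filterlim_cong)
qed

text \<open>The segment from the identity to the pencil consists of positive definite matrices. Its
  determinant starts at 1 and never vanishes, so it stays positive.\<close>

lemma det_pencil_pos:
  fixes x :: real and z :: "nat \<Rightarrow> real"
  assumes pd: "\<And>y. y \<noteq> 0 \<Longrightarrow> x * (norm y)^2 + (\<Sum>k=1..n. z k * (cmod (cip (u k) y))^2) > 0"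
  shows "Re (det (pencil u n (of_real x) (\<lambda>k. of_real (z k)))) > 0"
proof -
  define h where "h t = Re (det (pencil u n (of_real (1 + t * (x - 1))) (\<lambda>k. of_real (t * z k))))" for t :: real
  have cont: "continuous_on {0..1} h"
    unfolding h_def continuous_on_def
    by (intro ballI tendsto_Re tendsto_det_pencil tendsto_intros)
  have nz: "h t \<noteq> 0" if t: "0 \<le> t" "t \<le> 1" for t
  proof
    assume "h t = 0"
    then have "det (pencil u n (of_real (1 + t * (x - 1))) (\<lambda>k. of_real (t * z k))) = 0"
      using det_pencil_real[of u n "1 + t * (x - 1)" "\<lambda>k. t * z k"]
      by (simp only: h_def complex_is_Real_iff complex_eq_iff) simp
    then obtain y where y: "pencil u n (of_real (1 + t * (x - 1))) (\<lambda>k. of_real (t * z k)) *v y = 0" "y \<noteq> 0"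
      using det_nonzero_iff_ker by blast
    have "Re (cip y (pencil u n (of_real (1 + t * (x - 1))) (\<lambda>k. of_real (t * z k)) *v y)) = 0" using y by simp
    then have "(1 + t * (x - 1)) * (norm y)^2 + (\<Sum>k=1..n. t * z k * (cmod (cip (u k) y))^2) = 0"
      unfolding cip_pencil of_real_mult[symmetric] of_real_sum[symmetric] of_real_add[symmetric] Re_complex_of_real .
    then have eq: "(1 - t) * (norm y)^2 + t * (x * (norm y)^2 + (\<Sum>k=1..n. z k * (cmod (cip (u k) y))^2)) = 0"
      by (simp add: algebra_simps sum_distrib_left)
    show False
    proof (cases "t = 0")
      case True then show False using eq y by simp
    next
      case False
      then have "t * (x * (norm y)^2 + (\<Sum>k=1..n. z k * (cmod (cip (u k) y))^2)) > 0" using t pd[OF y(2)] by simp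
      moreover have "(1 - t) * (norm y)^2 \<ge> 0" using t by simp
      ultimately show False using eq by linarith
    qed
  qed
  have h0: "h 0 = 1" by (simp add: h_def)
  have "h 1 > 0"
  proof (rule ccontr)
    assume "\<not> h 1 > 0"
    then have "\<exists>t. 0 \<le> t \<and> t \<le> 1 \<and> h t = 0" by (intro IVT2') (use h0 cont in auto)
    then show False using nz by blast
  qed
  then show ?thesis by (simp add: h_def)
qed

text \<open>Changing basis so that \<open>u\<close> becomes a unit vector reduces the claim to linearity of the
  determinant in one row.\<close>

lemma det_rank_one_update_affine:
  fixes A :: "complex ^ 'd ^ 'd"
  shows "\<exists>a b. \<forall>t. det (\<chi> i j. A $ i $ j + t * (u $ i * w $ j)) = a + t * b"
proof (cases "u = 0")
  case True
  then show ?thesis by (intro exI[of _ "det A"] exI[of _ 0]) simp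
next
  case False
  then obtain k where k: "u $ k \<noteq> 0" by (auto simp: vec_eq_iff)
  \<comment> \<open>The identity with column \<open>k\<close> replaced by \<open>u\<close>. In this
    basis the rank one term adds \<open>t\<close> times \<open>w\<close> to row \<open>k\<close> of
    \<open>C\<close>.\<close>
  define V :: "complex ^ 'd ^ 'd" where "V = (\<chi> i j. if j = k then u $ i else mat 1 $ i $ j)"
  have "det V = u $ k"
    using cramer_lemma[where A = "mat 1" and x = u and k = k, unfolded matrix_vector_mul_lid] by (simp add: V_def)
  then obtain V' where V': "V ** V' = mat 1"
    using k by (metis invertible_det_nz invertible_right_inverse)
  define C where "C = V' ** A"
  have VC: "V ** C = A" by (simp add: C_def matrix_mul_assoc V')
  have "det (\<chi> i j. A $ i $ j + t * (u $ i * w $ j)) =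
     det V * det (\<chi> i. if i = k then C $ k else C $ i) + t * (det V * det (\<chi> i. if i = k then w else C $ i))" for t
  proof -
    define D :: "complex ^ 'd ^ 'd" where "D = (\<chi> i. if i = k then C $ k + t *s w else C $ i)"
    have "(\<chi> i j. A $ i $ j + t * (u $ i * w $ j)) = V ** D"
    proof -
      have "(V ** D) $ i $ j = (\<Sum>l\<in>UNIV. V $ i $ l * C $ l $ j + (if l = k then V $ i $ l * (t * w $ j) else 0))" for i j
        unfolding matrix_matrix_mult_def by (auto intro!: sum.cong simp: D_def algebra_simps)
      then have "(V ** D) $ i $ j = (V ** C) $ i $ j + V $ i $ k * (t * w $ j)" for i j
        by (simp add: sum.distrib matrix_matrix_mult_def)
      then show ?thesis unfolding VC by (simp add: vec_eq_iff V_def)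
    qed
    then show ?thesis
      by (simp add: det_mul D_def det_row_add det_row_mul algebra_simps)
  qed
  then show ?thesis by blast
qed

lemma det_pencil_affine:
  fixes u :: "nat \<Rightarrow> complex ^ 'd"
  shows "det (pencil u n x (z(k := t))) = det (pencil u n x (z(k := 0)))
    + t * (det (pencil u n x (z(k := 1))) - det (pencil u n x (z(k := 0))))"
proof -
  have "\<exists>a b. \<forall>t. det (pencil u n x (z(k := t))) = a + t * b"
  proof (cases "k \<in> {1..n}")
    case True
    have *: "pencil u n x (z(k := t)) = (\<chi> i j. pencil u n x (z(k := 0)) $ i $ j + t * (u k $ i * (\<chi> j. cnj (u k $ j)) $ j))" for t
    proof -
      have "(\<Sum>l=1..n. (z(k := t)) l * (u l $ i * cnj (u l $ j)))
         = t * (u k $ i * cnj (u k $ j)) + (\<Sum>l\<in>{1..n} - {k}. z l * (u l $ i * cnj (u l $ j)))" for t i j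
        using True by (subst sum.remove[of _ k]) (auto intro!: sum.cong)
      note upd = this
      have "pencil u n x (z(k := t)) $ i $ j = pencil u n x (z(k := 0)) $ i $ j + t * (u k $ i * cnj (u k $ j))" for i j
        unfolding pencil_def vec_lambda_beta upd[of t] upd[of 0] by (simp only: mult_zero_left add_0 ac_simps)
      then show ?thesis unfolding vec_eq_iff vec_lambda_beta by blast
    qed
    from det_rank_one_update_affine[of "pencil u n x (z(k := 0))" "u k" "\<chi> j. cnj (u k $ j)"]
    show ?thesis by (simp only: *[symmetric])
  next
    case False
    then have "pencil u n x (z(k := t)) = pencil u n x z" for t
      by (auto simp: pencil_def vec_eq_iff intro!: sum.cong)
    then show ?thesis by (intro exI[of _ "det (pencil u n x z)"] exI[of _ 0]) simp
  qed
  then obtain a b where "\<And>t. det (pencil u n x (z(k := t))) = a + t * b" by blast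
  then show ?thesis by simp
qed

text \<open>A unit vector \<open>x\<close> that the Hermitian matrix \<open>M\<close> stretches
  most, by \<open>N\<close>, satisfies \<open>M *v (M *v x) = N^2 *\<^sub>R x\<close>. Hence
  \<open>N\<close> or \<open>- N\<close> is an eigenvalue, and the two determinant conditions
  exclude both when \<open>N > R\<close>.\<close>

lemma norm_pencil_le:
  fixes u :: "nat \<Rightarrow> complex ^ 'd" and z :: "nat \<Rightarrow> real"
  assumes R: "R \<ge> 0"
    and nz: "\<And>r. r > R \<Longrightarrow> det (pencil u n (of_real r) (\<lambda>k. of_real (z k))) \<noteq> 0"
      "\<And>r. r > R \<Longrightarrow> det (pencil u n (of_real r) (\<lambda>k. of_real (- z k))) \<noteq> 0"
  shows "spec_norm (pencil u n 0 (\<lambda>k. of_real (z k))) \<le> R"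
proof -
  define M where "M = pencil u n 0 (\<lambda>k. of_real (z k))"
  have Mx: "M *v x = (\<Sum>k=1..n. (of_real (z k) * cip (u k) x) *s u k)" for x
    by (simp add: M_def pencil_mult_vec)
  have cipM: "cip y (M *v x) = (\<Sum>k=1..n. of_real (z k) * (cip (u k) x * cip y (u k)))" for x y
    by (simp add: Mx cip_sum_right cip_smult_right mult.assoc)
  have sym: "inner y (M *v x) = inner (M *v y) x" for x y
  proof -
    have "cip (M *v y) x = cnj (cip x (M *v y))" by (simp add: cnj_cip)
    also have "\<dots> = cip y (M *v x)" by (simp add: cipM cnj_cip mult.commute)
    finally show ?thesis by (simp add: inner_eq_Re_cip)
  qed
  have bl: "bounded_linear ((*v) M)" by simp
  obtain x where x: "norm x = 1" and max: "\<And>y. norm y = 1 \<Longrightarrow> norm (M *v y) \<le> norm (M *v x)"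
  proof -
    have "sphere (0 :: complex ^ 'd) 1 \<noteq> {}" by (metis sphere_eq_empty zero_le_one not_less)
    moreover have "continuous_on (sphere 0 1) (\<lambda>y. norm (M *v y))"
      by (intro continuous_intros linear_continuous_on bl)
    ultimately obtain x where "x \<in> sphere 0 1" "\<forall>y\<in>sphere 0 1. norm (M *v y) \<le> norm (M *v x)"
      using continuous_attains_sup[OF compact_sphere] by blast
    then show thesis using that[of x] by auto
  qed
  define N where "N = norm (M *v x)"
  have le: "norm (M *v y) \<le> N * norm y" for y
  proof (cases "y = 0")
    case False
    have "M *v y = norm y *\<^sub>R (M *v ((1 / norm y) *\<^sub>R y))"
      using False by (simp add: linear_cmul[OF bounded_linear.linear[OF bl]])
    then have "norm (M *v y) = norm y * norm (M *v ((1 / norm y) *\<^sub>R y))" by (metis norm_scaleR abs_norm_cancel)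
    also have "\<dots> \<le> norm y * N" unfolding N_def using False by (intro mult_left_mono max) auto
    finally show ?thesis by (simp add: mult.commute)
  qed simp
  have "N \<le> R"
  proof (rule ccontr)
    assume "\<not> N \<le> R"
    then have NR: "N > R" by simp
    \<comment> \<open>The inner product equals \<open>N^2\<close> by symmetry and the first square
      is at most \<open>N^4\<close>, so the three terms add up to at most 0.\<close>
    have "(norm (M *v (M *v x) - N^2 *\<^sub>R x))^2 = (norm (M *v (M *v x)))^2 - 2 * N^2 * inner (M *v (M *v x)) x + N^4"
    proof -
      have "(norm (a - b))^2 = (norm a)^2 - 2 * inner a b + (norm b)^2" for a b :: "complex ^ 'd"
        by (simp add: power2_norm_eq_inner inner_diff inner_commute)
      then show ?thesis using x by simp
    qed
    also have "inner (M *v (M *v x)) x = N^2"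
      using sym[of "M *v x" x] by (simp add: N_def power2_norm_eq_inner)
    also have "(norm (M *v (M *v x)))^2 \<le> N^4"
    proof -
      have "norm (M *v (M *v x)) \<le> N^2" using le[of "M *v x"] by (simp add: N_def power2_eq_square)
      from power_mono[OF this, of 2] show ?thesis by (simp flip: power_mult)
    qed
    finally have "(norm (M *v (M *v x) - N^2 *\<^sub>R x))^2 \<le> 0" by (simp add: power2_eq_square power4_eq_xxxx)
    then have MM: "M *v (M *v x) = N^2 *\<^sub>R x" by simp
    have plus: "pencil u n (of_real r) (\<lambda>k. of_real (z k)) *v y = r *\<^sub>R y + M *v y" for r y
      by (simp add: pencil_mult_vec Mx vec_eq_iff) (simp add: scaleR_conv_of_real)
    have minus: "pencil u n (of_real r) (\<lambda>k. of_real (- z k)) *v y = r *\<^sub>R y - M *v y" for r y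
      by (simp add: pencil_mult_vec Mx vec_eq_iff sum_negf) (simp add: scaleR_conv_of_real)
    \<comment> \<open>\<open>N - M\<close> annihilates \<open>y\<close>, the image of
      \<open>x\<close> under \<open>N + M\<close>; both factors are injective, so \<open>x\<close>
      would be 0.\<close>
    define y where "y = N *\<^sub>R x + M *v x"
    have "N *\<^sub>R y - M *v y = 0"
      unfolding y_def using MM by (simp add: linear_add[OF bounded_linear.linear[OF bl]] linear_cmul[OF bounded_linear.linear[OF bl]] scaleR_add_right power2_eq_square)
    then have "y = 0" using nz(2)[OF NR] minus[of N y] det_nonzero_iff_ker by metis
    then have "x = 0" using nz(1)[OF NR] plus[of N x] det_nonzero_iff_ker unfolding y_def by metis
    then show False using x by simp
  qed
  have "onorm ((*v) M) \<le> R"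
  proof (rule onorm_le)
    show "norm (M *v y) \<le> R * norm y" for y
      using le[of y] mult_right_mono[OF \<open>N \<le> R\<close>, of "norm y"] by simp
  qed
  then show ?thesis by (simp add: spec_norm_def M_def)
qed

text \<open>If the slope were larger, the determinant, affine in \<open>z j\<close>, would vanish
  after lowering \<open>z j\<close> by some \<open>t\<close> with
  \<open>t * (norm (u j))^2 < c\<close>. By Cauchy-Schwarz this lowering costs less than
  \<open>c\<close>, so the pencil would still be positive definite.\<close>

lemma det_pencil_slope_le:
  fixes x c :: real and z :: "nat \<Rightarrow> real"
  assumes c: "c > 0"
    and pd: "\<And>y. c * (norm y)^2 \<le> x * (norm y)^2 + (\<Sum>k=1..n. z k * (cmod (cip (u k) y))^2)"
  shows "slope (\<lambda>z. Re (det (pencil u n (of_real x) (\<lambda>k. of_real (z k))))) j z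
    \<le> (norm (u j))^2 / c * Re (det (pencil u n (of_real x) (\<lambda>k. of_real (z k))))"
proof (rule ccontr)
  define f where "f = (\<lambda>z. Re (det (pencil u n (of_real x) (\<lambda>k. of_real (z k)))))"
  assume "\<not> ?thesis"
  then have neg: "slope f j z > (norm (u j))^2 / c * f z" by (simp add: f_def)
  have "f z > 0" unfolding f_def
  proof (rule det_pencil_pos)
    fix y :: "complex ^ 'a" assume "y \<noteq> 0"
    then have "c * (norm y)^2 > 0" using c by simp
    then show "x * (norm y)^2 + (\<Sum>k=1..n. z k * (cmod (cip (u k) y))^2) > 0" using pd[of y] by linarith
  qed
  moreover have "(norm (u j))^2 / c \<ge> 0" using c by simp
  ultimately have S: "slope f j z > 0" using neg by (meson less_imp_le mult_nonneg_nonneg order_le_less_trans)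
  have f: "multiaffine f"
  proof (rule multiaffine_of_real)
    show "complex_of_real (f z) = det (pencil u n (of_real x) (\<lambda>k. of_real (z k)))" for z
      unfolding f_def using det_pencil_real[of u n x z] by (simp add: complex_is_Real_iff complex_eq_iff)
    show "multiaffine (\<lambda>z. det (pencil u n (of_real x) z))"
      unfolding multiaffine_def slope_def using det_pencil_affine by blast
  qed
  \<comment> \<open>The distance from \<open>z j\<close> down to the zero of the affine
    function.\<close>
  define t where "t = f z / slope f j z"
  have t: "t \<ge> 0" "t * (norm (u j))^2 < c"
    using S neg c \<open>f z > 0\<close> by (simp_all add: t_def field_simps)
  have "f (z(j := z j + - t)) > 0" unfolding f_def
  proof (rule det_pencil_pos)
    fix y :: "complex ^ 'a" assume "y \<noteq> 0"
    have "(\<Sum>k=1..n. z k * (cmod (cip (u k) y))^2) - t * (norm (u j))^2 * (norm y)^2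
        \<le> (\<Sum>k=1..n. (z(j := z j + - t)) k * (cmod (cip (u k) y))^2)"
    proof (cases "j \<in> {1..n}")
      case True
      have "(\<Sum>k=1..n. (z(j := z j + - t)) k * (cmod (cip (u k) y))^2)
          = (\<Sum>k=1..n. z k * (cmod (cip (u k) y))^2 - (if k = j then t * (cmod (cip (u j) y))^2 else 0))"
        by (intro sum.cong) (auto simp: algebra_simps)
      also have "\<dots> = (\<Sum>k=1..n. z k * (cmod (cip (u k) y))^2) - t * (cmod (cip (u j) y))^2"
        using True by (simp add: sum_subtractf)
      also have "\<dots> \<ge> (\<Sum>k=1..n. z k * (cmod (cip (u k) y))^2) - t * ((norm (u j))^2 * (norm y)^2)"
        using mult_left_mono[OF cmod_cip_le t(1)] by simp
      finally show ?thesis by (simp add: mult.assoc)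
    next
      case False
      then have "(\<Sum>k=1..n. (z(j := z j + - t)) k * (cmod (cip (u k) y))^2) = (\<Sum>k=1..n. z k * (cmod (cip (u k) y))^2)"
        by (intro sum.cong) auto
      then show ?thesis using t(1) by simp
    qed
    moreover have "t * (norm (u j))^2 * (norm y)^2 < c * (norm y)^2"
      using t(2) \<open>y \<noteq> 0\<close> by simp
    ultimately show "x * (norm y)^2 + (\<Sum>k=1..n. (z(j := z j + - t)) k * (cmod (cip (u k) y))^2) > 0"
      using pd[of y] by linarith
  qed
  moreover have "f (z(j := z j + - t)) = f z - t * slope f j z"
    using multiaffine_shift[OF f, of z j "z j" "- t"] by simp
  ultimately show False using S by (simp add: t_def)
qed

section \<open>The discrepancy bound\<close>

text \<open>The \<open>True\<close> factor later receives the negated choices of the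
  \<open>False\<close> factor, so one nonzero product excludes eigenvalues of both signs.\<close>

definition pencil_pair :: "(nat \<Rightarrow> complex ^ 'd) \<Rightarrow> nat \<Rightarrow> complex \<Rightarrow> (nat \<times> bool \<Rightarrow> complex) \<Rightarrow> complex" where
  "pencil_pair u n x y = det (pencil u n x (\<lambda>i. y (i, True))) * det (pencil u n x (\<lambda>i. y (i, False)))"

lemma curry_upd: "(\<lambda>i. (y((k, b) := t)) (i, b')) = (if b = b' then (\<lambda>i. y (i, b'))(k := t) else (\<lambda>i. y (i, b')))"
  by (auto simp: fun_eq_iff)

lemma stable_family_pencil_pair:
  fixes u :: "nat \<Rightarrow> complex ^ 'd"
  shows "stable_family (pencil_pair u n) (CARD('d) + CARD('d))"
proof
  show "multiaffine (pencil_pair u n x)" for x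
    unfolding multiaffine_def
  proof (intro allI)
    fix y :: "nat \<times> bool \<Rightarrow> complex" and v :: "nat \<times> bool" and t
    obtain k b where v: "v = (k, b)" by (cases v)
    show "pencil_pair u n x (y(v := t)) = pencil_pair u n x (y(v := 0)) + t * slope (pencil_pair u n x) v y"
      by (cases b) (simp_all add: v slope_def pencil_pair_def curry_upd det_pencil_affine[where t = t] algebra_simps del: fun_upd_apply)
  qed
  show "pencil_pair u n x y \<noteq> 0" if "Im x > 0" "\<And>v. Im (y v) \<ge> 0" for x y
    using that by (simp add: pencil_pair_def det_pencil_nonzero)
  show "(\<lambda>x. pencil_pair u n x y) holomorphic_on UNIV" for y
    unfolding pencil_pair_def by (intro holomorphic_intros holomorphic_det_pencil)
  show "cnj (pencil_pair u n x y) = pencil_pair u n (cnj x) (\<lambda>v. cnj (y v))" for x y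
    by (simp add: pencil_pair_def cnj_det_pencil)
  show "((\<lambda>x::real. pencil_pair u n (of_real x) y / of_real x ^ (CARD('d) + CARD('d))) \<longlongrightarrow> 1) at_top" for y
    using tendsto_mult[OF det_pencil_growth[of u n "\<lambda>i. y (i, True)"] det_pencil_growth[of u n "\<lambda>i. y (i, False)"]]
    by (simp add: pencil_pair_def power_add)
qed

text \<open>The case of centred variables with variances \<open>c\<close>; \<open>bound\<close> says
  that the quadratic form of the variance matrix is at most \<open>s^2\<close>.\<close>

lemma exists_small_discrepancy:
  fixes u :: "nat \<Rightarrow> complex ^ 'd" and p :: "nat \<Rightarrow> real \<Rightarrow> real" and I :: "nat \<Rightarrow> real set"
  assumes s: "s > 0" and c: "\<And>j. c j \<ge> 0"
    and bound: "\<And>y. (\<Sum>i=1..n. c i * (norm (u i))^2 * (cmod (cip (u i) y))^2) \<le> s^2 * (norm y)^2"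
    and I: "\<And>i. i \<in> {1..n} \<Longrightarrow> finite (I i)"
    and p: "\<And>i e. i \<in> {1..n} \<Longrightarrow> e \<in> I i \<Longrightarrow> p i e \<ge> 0" "\<And>i. i \<in> {1..n} \<Longrightarrow> (\<Sum>e\<in>I i. p i e) = 1"
    and mean: "\<And>i. i \<in> {1..n} \<Longrightarrow> (\<Sum>e\<in>I i. p i e * e) = 0"
    and var: "\<And>i. i \<in> {1..n} \<Longrightarrow> (\<Sum>e\<in>I i. p i e * e^2) = c i"
  shows "\<exists>e. (\<forall>i\<in>{1..n}. e i \<in> I i) \<and> spec_norm (pencil u n 0 (\<lambda>k. of_real (e k))) \<le> 3 * s"
proof -
  interpret stable_family "pencil_pair u n" "CARD('d) + CARD('d)" by (rule stable_family_pencil_pair)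
  \<comment> \<open>Lowering every coordinate to \<open>- d j\<close> costs at most \<open>s\<close>
    by \<open>bound\<close>, so for \<open>x > 3 * s\<close> the pencil stays at least
    \<open>2 * s\<close> times the identity, and \<open>det_pencil_slope_le\<close> gives
    \<open>C\<close>. Then \<open>c i * (2 * C i) = d i\<close>, exactly what the barrier
    requires.\<close>
  define d C where "d i = c i * (norm (u i))^2 / s" and "C i = (norm (u i))^2 / (2 * s)" for i
  define f where "f x z = Re (det (pencil u n (of_real x) (\<lambda>k. of_real (z k))))" for x :: real and z
  have f: "complex_of_real (f x z) = det (pencil u n (of_real x) (\<lambda>k. of_real (z k)))" for x z
    unfolding f_def using det_pencil_real[of u n x z] by (simp add: complex_is_Real_iff complex_eq_iff)
  have Q0: "Qr m c 0 x y = f x (\<lambda>i. y (i, True)) * f x (\<lambda>i. y (i, False))" for m c x y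
  proof -
    have "complex_of_real (Qr m c 0 x y) = of_real (f x (\<lambda>i. y (i, True)) * f x (\<lambda>i. y (i, False)))"
      unfolding of_real_Qr of_real_mult f by (simp add: pencil_pair_def)
    then show ?thesis by (simp only: of_real_eq_iff)
  qed
  have pd: "2 * s * (norm y)^2 \<le> x * (norm y)^2 + (\<Sum>k=1..n. z k * (cmod (cip (u k) y))^2)"
    if x: "x > 3 * s" and z: "\<And>j. j \<ge> 1 \<Longrightarrow> z j \<ge> - d j" for x z and y :: "complex ^ 'd"
  proof -
    have "- (\<Sum>k=1..n. z k * (cmod (cip (u k) y))^2) \<le> (\<Sum>k=1..n. d k * (cmod (cip (u k) y))^2)"
      unfolding sum_negf[symmetric]
    proof (rule sum_mono)
      fix k assume "k \<in> {1..n}"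
      then have "- z k \<le> d k" using z[of k] by simp
      then show "- (z k * (cmod (cip (u k) y))^2) \<le> d k * (cmod (cip (u k) y))^2"
        using mult_right_mono[of "- z k" "d k" "(cmod (cip (u k) y))^2"] by simp
    qed
    also have "\<dots> = (\<Sum>i=1..n. c i * (norm (u i))^2 * (cmod (cip (u i) y))^2) / s"
      by (simp add: d_def sum_divide_distrib)
    also have "\<dots> \<le> s * (norm y)^2"
      using bound[of y] s by (simp add: pos_divide_le_eq power2_eq_square mult_ac)
    finally have "s * (norm y)^2 \<ge> - (\<Sum>k=1..n. z k * (cmod (cip (u k) y))^2)" .
    moreover have "3 * s * (norm y)^2 \<le> x * (norm y)^2" using x by (intro mult_right_mono) auto
    ultimately show ?thesis by linarith
  qed
  have fpos: "f x z > 0" if x: "x > 3 * s" and z: "\<And>j. j \<ge> 1 \<Longrightarrow> z j \<ge> - d j" for x z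
    unfolding f_def
  proof (rule det_pencil_pos)
    fix y :: "complex ^ 'd" assume "y \<noteq> 0"
    then have "2 * s * (norm y)^2 > 0" using s by simp
    then show "x * (norm y)^2 + (\<Sum>k=1..n. z k * (cmod (cip (u k) y))^2) > 0" using pd[OF x z, of y] by linarith
  qed
  have fslope: "slope (f x) j z \<le> C j * f x z" if x: "x > 3 * s" and z: "\<And>j. j \<ge> 1 \<Longrightarrow> z j \<ge> - d j" for x z j
    using det_pencil_slope_le[where c = "2 * s" and x = x and n = n and z = z and u = u and j = j] s pd[OF x z] unfolding f_def C_def by simp
  have avg: "Qr (\<lambda>_. 0) c n x (\<lambda>_. 0) > 0" if x: "x > 3 * s" for x
  proof (rule barrier[where d = d and C = C])
    show "c i \<ge> 0" for i by (rule c)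
    show "d i \<ge> 0" "c i * (2 * C i) \<le> d i" for i using s c by (simp_all add: d_def C_def)
    fix y :: "nat \<times> bool \<Rightarrow> real" assume y: "\<And>j b. j \<ge> 1 \<Longrightarrow> y (j, b) \<ge> - d j"
    have p: "f x (\<lambda>i. y (i, b)) > 0" for b by (rule fpos[OF x]) (use y in auto)
    show "Qr (\<lambda>_. 0) c 0 x y > 0" unfolding Q0 using p by simp
    fix j b assume "1 \<le> (j::nat)"
    have sl: "slope (f x) j (\<lambda>i. y (i, b)) \<le> C j * f x (\<lambda>i. y (i, b))" for b
      by (rule fslope[OF x]) (use y in auto)
    have "slope (Qr (\<lambda>_. 0) c 0 x) (j, b) y = slope (f x) j (\<lambda>i. y (i, b)) * f x (\<lambda>i. y (i, \<not> b))"
      by (cases b) (simp_all add: slope_def Q0 curry_upd algebra_simps del: fun_upd_apply)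
    also have "\<dots> \<le> (C j * f x (\<lambda>i. y (i, b))) * f x (\<lambda>i. y (i, \<not> b))"
      using p[of "\<not> b"] by (intro mult_right_mono sl) auto
    also have "\<dots> = C j * Qr (\<lambda>_. 0) c 0 x y" by (cases b) (simp_all add: Q0)
    finally show "slope (Qr (\<lambda>_. 0) c 0 x) (j, b) y \<le> C j * Qr (\<lambda>_. 0) c 0 x y" .
  qed
  from select_all[OF c I p mean var avg]
  obtain e where e: "\<forall>i\<in>{1..n}. e i \<in> I i" and Qe: "\<And>x. x > 3 * s \<Longrightarrow> Qr e (\<lambda>_. 0) n x (\<lambda>_. 0) > 0"
    by blast
  have P: "det (pencil u n (of_real r) (\<lambda>k. of_real (- e k))) * det (pencil u n (of_real r) (\<lambda>k. of_real (e k))) \<noteq> 0"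
    if "r > 3 * s" for r
  proof -
    \<comment> \<open>Outside \<open>{1..n}\<close> the substitution leaves the value 0, which the
      pencil does not see.\<close>
    have cong: "pencil u n x (\<lambda>k. if 1 \<le> k \<and> k \<le> n then z k else 0) = pencil u n x z" for x z
      by (auto simp: pencil_def vec_eq_iff intro!: sum.cong)
    have "Q e (\<lambda>_. 0) n (of_real r) (\<lambda>_. 0) = det (pencil u n (of_real r) (\<lambda>k. of_real (- e k))) * det (pencil u n (of_real r) (\<lambda>k. of_real (e k)))"
      using cong[of "of_real r" "\<lambda>k. of_real (- e k)"] cong[of "of_real r" "\<lambda>k. of_real (e k)"]
      by (simp add: Q_def iter_op_zero_variance pencil_pair_def cong: if_cong del: One_nat_def)
    then show ?thesis using Qe[OF that] by (auto simp: Qr_def)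
  qed
  have "spec_norm (pencil u n 0 (\<lambda>k. of_real (e k))) \<le> 3 * s"
    by (rule norm_pencil_le) (use s P in auto)
  then show ?thesis using e by blast
qed

section \<open>Return to the random matrices\<close>

lemma scaleR_matrix_vector_mult: "(r *\<^sub>R A) *v y = r *\<^sub>R (A *v y)" for A :: "complex ^ 'd ^ 'd"
  by (simp add: vec_eq_iff matrix_vector_mult_def scaleR_sum_right)

lemma sum_matrix_vector_mult: "(\<Sum>i\<in>K. A i) *v y = (\<Sum>i\<in>K. A i *v y)" for A :: "'k \<Rightarrow> complex ^ 'd ^ 'd"
  by (induction K rule: infinite_finite_induct) (auto simp: matrix_vector_mult_add_rdistrib)

text \<open>The square of \<open>outer v\<close> is \<open>(norm v)^2\<close> times
  \<open>outer v\<close>, which links the variance matrix to the form in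
  \<open>bound\<close>.\<close>

lemma inner_sum_outer_square:
  fixes u :: "nat \<Rightarrow> complex ^ 'd"
  shows "inner y ((\<Sum>i\<in>K. c i *\<^sub>R (outer (u i) ** outer (u i))) *v y)
    = (\<Sum>i\<in>K. c i * (norm (u i))^2 * (cmod (cip (u i) y))^2)"
proof -
  have "inner y ((outer v ** outer v) *v y) = (norm v)^2 * (cmod (cip v y))^2" for v :: "complex ^ 'd"
  proof -
    have "cip y ((outer v ** outer v) *v y) = cip v v * (cip v y * cip y v)"
      by (simp add: matrix_vector_mul_assoc[symmetric] outer_mult_vec cip_smult_right mult_ac)
    then show ?thesis by (simp add: inner_eq_Re_cip cip_self cip_mult_flip flip: of_real_mult)
  qed
  then show ?thesis
    by (simp add: sum_matrix_vector_mult scaleR_matrix_vector_mult inner_sum_right mult.assoc)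
qed

theorem theorem1p3:
  fixes n :: nat
    and \<xi> :: "nat \<Rightarrow> real pmf"
    and u :: "nat \<Rightarrow> complex ^ 'd"
  assumes fin: "\<And>i. i \<in> {1..n} \<Longrightarrow> finite (set_pmf (\<xi> i))"
  defines "\<sigma> \<equiv> sqrt (spec_norm (\<Sum>i=1..n. measure_pmf.variance (\<xi> i) (\<lambda>x. x) *\<^sub>R (outer (u i) ** outer (u i))))"
  shows "Min ((\<lambda>\<epsilon>. spec_norm ((\<Sum>i=1..n. measure_pmf.expectation (\<xi> i) (\<lambda>x. x) *\<^sub>R outer (u i))
                                 - (\<Sum>i=1..n. \<epsilon> i *\<^sub>R outer (u i))))
             ` (Pi\<^sub>E {1..n} (\<lambda>i. set_pmf (\<xi> i)))) \<le> 3 * \<sigma>"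
    (is "Min (?f ` ?E) \<le> _")
proof -
  define \<mu> where "\<mu> i = measure_pmf.expectation (\<xi> i) (\<lambda>x. x)" for i
  define V where "V i = measure_pmf.variance (\<xi> i) (\<lambda>x. x)" for i
  define S where "S = (\<Sum>i=1..n. V i *\<^sub>R (outer (u i) ** outer (u i)))"
  have bl: "bounded_linear ((*v) S)" by simp
  have \<sigma>: "\<sigma> = sqrt (spec_norm S)" by (simp add: \<sigma>_def S_def V_def)
  have S0: "spec_norm S \<ge> 0" unfolding spec_norm_def by (rule onorm_pos_le[OF bl])
  have \<sigma>0: "\<sigma> \<ge> 0" using S0 by (simp add: \<sigma>)
  have V0: "V i \<ge> 0" for i unfolding V_def by (rule Bochner_Integration.integral_nonneg) simp
  have E: "finite ?E" by (intro finite_PiE fin) auto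
  \<comment> \<open>The centred case needs a positive bound and \<open>\<sigma>\<close> may be 0, so
    every \<open>s > \<sigma>\<close> is treated first and \<open>dense_ge\<close>
    concludes.\<close>
  have "Min (?f ` ?E) \<le> 3 * s" if s: "s > \<sigma>" for s
  proof -
    have "s > 0" using s \<sigma>0 by simp
    \<comment> \<open>The support of the mean minus the variable; with this sign the sum of the
      chosen \<open>e i *\<^sub>R outer (u i)\<close> is the difference of matrices in the
      claim.\<close>
    define I where "I i = (\<lambda>a. \<mu> i - a) ` set_pmf (\<xi> i)" for i
    have inj: "inj_on (\<lambda>a. \<mu> i - a) A" for i A by (auto simp: inj_on_def)
    have expect: "measure_pmf.expectation (\<xi> i) g = (\<Sum>a\<in>set_pmf (\<xi> i). pmf (\<xi> i) a * g a)"
      if "i \<in> {1..n}" for i and g :: "real \<Rightarrow> real"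
      by (subst integral_measure_pmf[of "set_pmf (\<xi> i)"]) (use fin that in auto)
    have total: "(\<Sum>a\<in>set_pmf (\<xi> i). pmf (\<xi> i) a) = 1" if "i \<in> {1..n}" for i
      by (rule sum_pmf_eq_1) (use fin that in auto)
    have "\<exists>e. (\<forall>i\<in>{1..n}. e i \<in> I i) \<and> spec_norm (pencil u n 0 (\<lambda>k. of_real (e k))) \<le> 3 * s"
    proof (rule exists_small_discrepancy[where c = V and p = "\<lambda>i e. pmf (\<xi> i) (\<mu> i - e)"])
      fix y :: "complex ^ 'd"
      have "(\<Sum>i=1..n. V i * (norm (u i))^2 * (cmod (cip (u i) y))^2) = inner y (S *v y)"
        by (simp add: S_def inner_sum_outer_square)
      also have "\<dots> \<le> norm y * norm (S *v y)" by (rule norm_cauchy_schwarz)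
      also have "\<dots> \<le> norm y * (spec_norm S * norm y)"
        unfolding spec_norm_def by (intro mult_left_mono onorm[OF bl]) auto
      also have "\<dots> = \<sigma>^2 * (norm y)^2" using S0 by (simp add: \<sigma> power2_eq_square)
      also have "\<dots> \<le> s^2 * (norm y)^2"
        using s \<sigma>0 by (intro mult_right_mono power_mono) auto
      finally show "(\<Sum>i=1..n. V i * (norm (u i))^2 * (cmod (cip (u i) y))^2) \<le> s^2 * (norm y)^2" .
    next
      fix i assume i: "i \<in> {1..n}"
      show "finite (I i)" using fin[OF i] by (simp add: I_def)
      show "(\<Sum>e\<in>I i. pmf (\<xi> i) (\<mu> i - e)) = 1"
        using total[OF i] by (simp add: I_def sum.reindex[OF inj])
      have "(\<Sum>e\<in>I i. pmf (\<xi> i) (\<mu> i - e) * e)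
          = \<mu> i * (\<Sum>a\<in>set_pmf (\<xi> i). pmf (\<xi> i) a) - (\<Sum>a\<in>set_pmf (\<xi> i). pmf (\<xi> i) a * a)"
        by (simp add: I_def sum.reindex[OF inj] algebra_simps sum_subtractf sum_distrib_left)
      then show "(\<Sum>e\<in>I i. pmf (\<xi> i) (\<mu> i - e) * e) = 0"
        using total[OF i] expect[OF i, of "\<lambda>x. x"] by (simp add: \<mu>_def)
      have "V i = (\<Sum>a\<in>set_pmf (\<xi> i). pmf (\<xi> i) a * (a - \<mu> i)^2)"
        using expect[OF i, of "\<lambda>x. (x - \<mu> i)^2"] by (simp add: V_def \<mu>_def)
      then show "(\<Sum>e\<in>I i. pmf (\<xi> i) (\<mu> i - e) * e^2) = V i"
        by (simp add: I_def sum.reindex[OF inj] power2_commute)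
    qed (use \<open>s > 0\<close> V0 in auto)
    then obtain e where e: "\<And>i. i \<in> {1..n} \<Longrightarrow> e i \<in> I i"
      "spec_norm (pencil u n 0 (\<lambda>k. of_real (e k))) \<le> 3 * s" by blast
    define \<epsilon> where "\<epsilon> = restrict (\<lambda>i. \<mu> i - e i) {1..n}"
    have "\<mu> i - e i \<in> set_pmf (\<xi> i)" if "i \<in> {1..n}" for i
      using e(1)[OF that] by (auto simp: I_def)
    then have "\<epsilon> \<in> ?E" unfolding \<epsilon>_def by (rule restrict_PiE_iff[THEN iffD2, OF ballI])
    have "(\<Sum>i=1..n. \<mu> i *\<^sub>R outer (u i)) - (\<Sum>i=1..n. \<epsilon> i *\<^sub>R outer (u i))
        = (\<Sum>i=1..n. e i *\<^sub>R outer (u i))"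
      unfolding sum_subtractf[symmetric] scaleR_left_diff_distrib[symmetric]
      by (intro sum.cong) (auto simp: \<epsilon>_def)
    also have "\<dots> = pencil u n 0 (\<lambda>k. of_real (e k))"
      by (simp add: vec_eq_iff pencil_def outer_def) (simp add: scaleR_conv_of_real)
    finally have "?f \<epsilon> \<le> 3 * s" using e(2) by (simp add: \<mu>_def)
    moreover have "Min (?f ` ?E) \<le> ?f \<epsilon>" using E \<open>\<epsilon> \<in> ?E\<close> by (intro Min_le) auto
    ultimately show ?thesis by linarith
  qed
  then have "Min (?f ` ?E) / 3 \<le> s" if "s > \<sigma>" for s using that by (simp add: field_simps)
  then have "Min (?f ` ?E) / 3 \<le> \<sigma>" by (rule dense_ge)
  then show ?thesis by simp
qed

end
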